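(* Let $X$ be a finitely suslinean continuum and let $f:X\to X$ be a minimal map. Then $f$ is not weakly mixing.
   Context: A continuum is a non-empty compact connected metric space; a subcontinuum is a subset that is a continuum. A family $\{A_i: i\in I\}$ of subsets of a metric space is null if for every $\epsilon>0$ there is a finite $J\subset I$ such that $\operatorname{diam}(A_i)<\epsilon$ for all $i\in I\setminus J$. A continuum is finitely suslinean if every family of pairwise disjoint subcontinua of it is null. A continuous map $f:X\to X$ of a compact metric space is minimal if there is no non-empty closed proper subset $M\subsetneq X$ with $f(M)\subset M$. The system $(X,f)$ is transitive if for all non-empty open $U,V\subset X$ there is $n\geq 1$ with $f^n(U)\cap V\neq\emptyset$, and weakly mixing if $f\times f:X\times X\to X\times X$ is transitive.
   Formalization: The continuum X is additionally assumed to have more than one point: on a one-point continuum the identity is minimal and weakly mixing, so the claim fails there. *)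

theory Defs
  imports "HOL-Analysis.Analysis"
begin

text \<open>
  Spaces are represented as subsets of a metric space type, carrying the subspace metric and topology;
  \<open>top_of_set X\<close> is the subspace topology on \<open>X\<close>, and a self-map of \<open>X\<close> is a total function on the
  type, of which only the values on \<open>X\<close> matter.
\<close>

text \<open>
  One-point sets are continua. The identity of a one-point space is minimal and weakly mixing, so
  results excluding weak mixing need the space itself to be nondegenerate.
\<close>

definition continuum :: "'a::metric_space set \<Rightarrow> bool"
  where "continuum X \<longleftrightarrow> X \<noteq> {} \<and> compact X \<and> connected X"

definition subcontinuum :: "'a::metric_space set \<Rightarrow> 'a set \<Rightarrow> bool"
  where "subcontinuum A X \<longleftrightarrow> A \<subseteq> X \<and> continuum A"

definition null_family :: "'i set \<Rightarrow> ('i \<Rightarrow> 'a::metric_space set) \<Rightarrow> bool"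
  where "null_family I A \<longleftrightarrow>
    (\<forall>\<epsilon>>0. \<exists>J\<subseteq>I. finite J \<and> (\<forall>i\<in>I - J. diameter (A i) < \<epsilon>))"

text \<open>
  Indexing the families by their own members loses nothing: subcontinua are non-empty, so a
  pairwise disjoint indexed family of them is injective.
\<close>

definition finitely_suslinean :: "'a::metric_space set \<Rightarrow> bool"
  where "finitely_suslinean X \<longleftrightarrow>
    (\<forall>\<A>. (\<forall>A\<in>\<A>. subcontinuum A X) \<and> pairwise disjnt \<A> \<longrightarrow> null_family \<A> (\<lambda>A. A))"

definition minimal_map :: "'a::metric_space set \<Rightarrow> ('a \<Rightarrow> 'a) \<Rightarrow> bool"
  where "minimal_map X f \<longleftrightarrow> continuous_on X f \<and> f \<in> X \<rightarrow> X \<and>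
    \<not> (\<exists>M. closedin (top_of_set X) M \<and> M \<noteq> {} \<and> M \<subset> X \<and> f ` M \<subseteq> M)"

definition transitive_system :: "'a::topological_space set \<Rightarrow> ('a \<Rightarrow> 'a) \<Rightarrow> bool"
  where "transitive_system X f \<longleftrightarrow>
    (\<forall>U V. openin (top_of_set X) U \<and> U \<noteq> {} \<and> openin (top_of_set X) V \<and> V \<noteq> {} \<longrightarrow>
      (\<exists>n\<ge>1. (f ^^ n) ` U \<inter> V \<noteq> {}))"

definition weakly_mixing :: "'a::topological_space set \<Rightarrow> ('a \<Rightarrow> 'a) \<Rightarrow> bool"
  where "weakly_mixing X f \<longleftrightarrow> transitive_system (X \<times> X) (map_prod f f)"

end

theory Submission
  imports Defs
begin

text \<open>
  Let \<open>f\<close> be minimal and weakly mixing. A subcontinuum \<open>K\<close> is asymptotic if the diameters of its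
  iterates tend to \<open>0\<close>. If \<open>K\<close> is not asymptotic, then two iterates of \<open>K\<close> meet since \<open>X\<close> is
  finitely suslinean, and the diameters stay away from \<open>0\<close> since there are no periodic points. If they
  also remained small, then the integers \<open>d\<close> for which some iterate of \<open>K\<close> meets its \<open>d\<close>-th image
  would meet every difference set, while \<open>f\<^sup>d\<close> would be uniformly close to the identity; this
  contradicts weak mixing, which makes hitting times thick. Hence continua with small iterates are
  asymptotic. Maximal asymptotic continua form a null upper semicontinuous decomposition of \<open>X\<close>, and
  after collapsing it all nondegenerate continua grow to a definite size under a fixed iterate of \<open>f\<close>.
  An argument of Mane then produces an orbit of this iterate that misses a ball, which is impossible.
\<close>

subsection \<open>Continua and limits of sets\<close>

lemma finitely_suslinean_finite:
  assumes "finitely_suslinean X" "0 < \<epsilon>" "pairwise disjnt \<A>"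
    and A: "\<And>A. A \<in> \<A> \<Longrightarrow> subcontinuum A X \<and> (\<exists>x\<in>A. \<exists>y\<in>A. \<epsilon> \<le> dist x y)"
  shows "finite \<A>"
proof -
  have "\<forall>A\<in>\<A>. subcontinuum A X"
    using A by blast
  then have "null_family \<A> (\<lambda>A. A)"
    using assms(1,3) unfolding finitely_suslinean_def by metis
  then obtain J where J: "J \<subseteq> \<A>" "finite J" "\<forall>A\<in>\<A> - J. diameter A < \<epsilon>"
    unfolding null_family_def using \<open>0 < \<epsilon>\<close> by metis
  have "A \<in> J" if AA: "A \<in> \<A>" for A
  proof (rule ccontr)
    assume "A \<notin> J"
    then have "diameter A < \<epsilon>"
      using AA J by blast
    moreover have "bounded A"
      using A[OF AA] by (auto simp: subcontinuum_def continuum_def compact_imp_bounded)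
    moreover obtain x y where "x \<in> A" "y \<in> A" "\<epsilon> \<le> dist x y"
      using A[OF AA] by blast
    ultimately show False
      using diameter_bounded_bound[of A x y] by simp
  qed
  then have "\<A> \<subseteq> J"
    by (rule subsetI)
  then show ?thesis
    using J(2) by (rule finite_subset)
qed

text \<open>Disjoint sets that each contain two distant points are distinct for distinct indices, so
  finiteness passes from sets to indices. For iterates of one continuum the index is the
  exponent.\<close>

lemma finitely_suslinean_finite_index:
  assumes X: "finitely_suslinean X" "0 < \<epsilon>"
    and S: "\<And>i. i \<in> I \<Longrightarrow> subcontinuum (S i) X" "\<And>i. i \<in> I \<Longrightarrow> \<exists>x\<in>S i. \<exists>y\<in>S i. \<epsilon> \<le> dist x y"
    and disj: "\<And>i j. i \<in> I \<Longrightarrow> j \<in> I \<Longrightarrow> i \<noteq> j \<Longrightarrow> S i \<inter> S j = {}"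
  shows "finite I"
proof (rule finite_imageD)
  show "finite (S ` I)"
  proof (rule finitely_suslinean_finite[OF X])
    show "pairwise disjnt (S ` I)"
    proof (rule pairwiseI)
      fix A B assume "A \<in> S ` I" "B \<in> S ` I" "A \<noteq> B"
      then obtain i j where "i \<in> I" "j \<in> I" "A = S i" "B = S j" "i \<noteq> j"
        by blast
      then show "disjnt A B"
        using disj by (simp add: disjnt_def)
    qed
    show "subcontinuum A X \<and> (\<exists>x\<in>A. \<exists>y\<in>A. \<epsilon> \<le> dist x y)" if "A \<in> S ` I" for A
      using that S by auto
  qed
  show "inj_on S I"
  proof (rule inj_onI, rule ccontr)
    fix i j assume "i \<in> I" "j \<in> I" "S i = S j" "i \<noteq> j"
    then show False
      using disj[of i j] S(2)[of i] by auto
  qed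
qed

lemma map_prod_funpow:
  fixes f :: "'a \<Rightarrow> 'a" and g :: "'b \<Rightarrow> 'b"
  shows "(map_prod f g ^^ n) = map_prod (f ^^ n) (g ^^ n)"
  by (induction n) (auto simp: fun_eq_iff)

lemma dist_le_closure:
  assumes "\<And>x y. x \<in> S \<Longrightarrow> y \<in> S \<Longrightarrow> dist x y \<le> e" "x \<in> closure S" "y \<in> closure S"
  shows "dist x y \<le> e"
proof -
  have "closed {z. dist (fst z) (snd z) \<le> e}"
    by (intro closed_Collect_le continuous_intros)
  then have "closure (S \<times> S) \<subseteq> {z. dist (fst z) (snd z) \<le> e}"
    using assms(1) by (intro closure_minimal) auto
  moreover have "(x, y) \<in> closure (S \<times> S)"
    using assms(2,3) by (simp add: closure_Times)
  ultimately show ?thesis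
    by auto
qed

lemma closed_disjoint_separation:
  fixes S T :: "'a::metric_space set"
  assumes "closed S" "closed T" "S \<inter> T = {}"
  obtains U V where "open U" "open V" "S \<subseteq> U" "T \<subseteq> V" "U \<inter> V = {}"
proof -
  have "normal_space (euclidean :: 'a topology)"
    by (intro metrizable_imp_normal_space metrizable_space_euclidean)
  from this[unfolded normal_space_def, rule_format, of S T] show thesis
    using assms that by (auto simp: disjnt_def)
qed

lemma compact_nest_nat:
  fixes F :: "nat \<Rightarrow> 'a::metric_space set"
  assumes F: "\<And>n. compact (F n)" "\<And>n. F n \<noteq> {}" and dec: "\<And>n. F (Suc n) \<subseteq> F n"
  shows "(\<Inter>n. F n) \<noteq> {}"
proof -
  have mono: "F n \<subseteq> F m" if "m \<le> n" for m n
    using that by (induction n rule: dec_induct) (use dec in auto)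
  have "F 0 \<inter> (\<Inter>n\<in>UNIV. F n) \<noteq> {}"
  proof (rule compact_imp_fip_image[OF F(1)])
    show "closed (F n)" for n
      using F(1) by (rule compact_imp_closed)
    show "F 0 \<inter> (\<Inter>n\<in>I. F n) \<noteq> {}" if "finite I" for I
    proof -
      obtain m where "\<forall>n\<in>I. n \<le> m"
        using \<open>finite I\<close> finite_nat_set_iff_bounded_le by blast
      then have "F m \<subseteq> F 0 \<inter> (\<Inter>n\<in>I. F n)"
        using mono by auto
      then show ?thesis
        using F(2)[of m] by blast
    qed
  qed
  then show ?thesis
    by blast
qed

lemma limit_in_limsup:
  fixes K :: "nat \<Rightarrow> 'a::metric_space set"
  assumes "\<And>k. u k \<in> K k" "u \<longlonglongrightarrow> z"
  shows "z \<in> (\<Inter>m. closure (\<Union>k\<in>{m..}. K k))"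
proof
  fix m
  have "u k \<in> closure (\<Union>k\<in>{m..}. K k)" if "m \<le> k" for k
    using assms(1)[of k] that by (intro closure_subset[THEN subsetD]) auto
  then have "\<forall>\<^sub>F k in sequentially. u k \<in> closure (\<Union>k\<in>{m..}. K k)"
    by (rule eventually_mono[OF eventually_ge_at_top])
  then show "z \<in> closure (\<Union>k\<in>{m..}. K k)"
    using assms(2) by (intro Lim_in_closed_set[OF closed_closure _ sequentially_bot])
qed

text \<open>The convergent selection \<open>u\<close> prevents a splitting. If the upper limit lay
  in disjoint open sets \<open>U\<close> and \<open>V\<close> with \<open>z\<close> in
  \<open>U\<close>, then by compactness all late \<open>K k\<close> would lie in
  \<open>U \<union> V\<close>. Being connected and containing \<open>u k\<close> in
  \<open>U\<close>, they would miss \<open>V\<close>, and so would the limit.\<close>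

lemma connected_limsup:
  fixes K :: "nat \<Rightarrow> 'a::metric_space set"
  assumes X: "compact X" and K: "\<And>k. connected (K k)" "\<And>k. K k \<subseteq> X"
    and u: "\<And>k. u k \<in> K k" "u \<longlonglongrightarrow> z"
  shows "connected (\<Inter>m. closure (\<Union>k\<in>{m..}. K k))" (is "connected ?L")
proof -
  have zL: "z \<in> ?L"
    using limit_in_limsup[of u K z] u by blast
  have False if AB: "closed A" "closed B" "z \<in> A" "B \<noteq> {}" "A \<union> B = ?L" "A \<inter> B = {}" for A B
  proof -
    obtain U V where UV: "open U" "open V" "A \<subseteq> U" "B \<subseteq> V" "U \<inter> V = {}"
      by (rule closed_disjoint_separation[OF AB(1,2,6)])
    \<comment> \<open>These compact sets decrease to the part of the upper limit outside
      \<open>U \<union> V\<close>, which is empty, so one of them is already empty.\<close>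
    define F where "F m = closure (\<Union>k\<in>{m..}. K k) - (U \<union> V)" for m
    have comp: "compact (F m)" for m
    proof -
      have "closure (\<Union>k\<in>{m..}. K k) \<subseteq> X"
        using K(2) X by (intro closure_minimal) (auto simp: compact_imp_closed)
      then have "compact (X \<inter> closure (\<Union>k\<in>{m..}. K k))" "X \<inter> closure (\<Union>k\<in>{m..}. K k) = closure (\<Union>k\<in>{m..}. K k)"
        using X by (auto intro: compact_Int_closed)
      then show ?thesis
        unfolding F_def using UV(1,2) by (intro compact_diff) auto
    qed
    have "F (Suc m) \<subseteq> F m" for m
      unfolding F_def by (intro Diff_mono closure_mono UN_mono) auto
    moreover have "(\<Inter>m. F m) = {}"
      using AB(5) UV(3,4) unfolding F_def by blast
    ultimately obtain m where "F m = {}"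
      using compact_nest_nat[of F] comp by blast
    then have m: "K k \<subseteq> U \<union> V" if "k \<ge> m" for k
      using that closure_subset[of "\<Union>k\<in>{m..}. K k"] unfolding F_def by blast
    have "\<forall>\<^sub>F k in sequentially. u k \<in> U"
      using u(2) UV(1,3) AB(3) by (intro topological_tendstoD) auto
    then obtain n where n: "\<And>k. k \<ge> n \<Longrightarrow> u k \<in> U"
      unfolding eventually_sequentially by blast
    have "K k \<inter> V = {}" if k: "k \<ge> max m n" for k
    proof -
      have "U \<inter> V \<inter> K k = {}"
        using UV(5) by blast
      then show ?thesis
        using connectedD[OF K(1) UV(1,2) _ m[of k]] k n[of k] u(1)[of k] by (auto simp: Int_commute)
    qed
    then have "(\<Union>k\<in>{max m n..}. K k) \<subseteq> - V"
      by (simp add: UN_subset_iff disjoint_eq_subset_Compl)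
    then have "closure (\<Union>k\<in>{max m n..}. K k) \<subseteq> - V"
      using UV(2) by (intro closure_minimal) auto
    then show False
      using AB(4,5) UV(4) by blast
  qed
  then have "\<nexists>A B. closed A \<and> closed B \<and> A \<noteq> {} \<and> B \<noteq> {} \<and> A \<union> B = ?L \<and> A \<inter> B = {}"
    using zL by (metis Int_commute Un_commute Un_iff)
  moreover have "closed ?L"
    by (intro closed_INT) auto
  ultimately show ?thesis
    using connected_closed_set by blast
qed

text \<open>A finite form of Baire's theorem: if \<open>U\<close> is not inside the last closed set,
  removing that set leaves a non-empty relatively open set covered by the others.\<close>

lemma openin_finite_closed_cover:
  fixes C :: "nat \<Rightarrow> 'a::topological_space set"
  assumes "\<And>i. closed (C i)" "openin (top_of_set X) U" "U \<noteq> {}" "U \<subseteq> (\<Union>i<n. C i)"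
  shows "\<exists>i<n. \<exists>V. openin (top_of_set X) V \<and> V \<noteq> {} \<and> V \<subseteq> C i"
  using assms(2-4)
proof (induction n arbitrary: U)
  case (Suc n)
  show ?case
  proof (cases "U \<subseteq> C n")
    case False
    have "openin (top_of_set X) (U - C n)"
      using Suc.prems(1) assms(1)[of n] by (simp add: Diff_eq openin_Int_open open_Compl)
    moreover have "U - C n \<subseteq> (\<Union>i<n. C i)"
      using Suc.prems(3) by (auto simp: lessThan_Suc)
    ultimately show ?thesis
      using Suc.IH[of "U - C n"] False less_SucI by blast
  qed (use Suc.prems in blast)
qed auto

subsection \<open>Minimal weakly mixing maps\<close>

locale minimal_weakly_mixing =
  fixes X :: "'a::metric_space set" and f :: "'a \<Rightarrow> 'a"
  assumes continuum_X: "continuum X"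
    and nondegenerate: "\<not> is_singleton X"
    and minimal: "minimal_map X f"
    and mixing: "weakly_mixing X f"
begin

lemma compact_X: "compact X" and nonempty_X: "X \<noteq> {}" and connected_X: "connected X"
  using continuum_X by (auto simp: continuum_def)

lemma f_in: "x \<in> X \<Longrightarrow> f x \<in> X" and continuous_f: "continuous_on X f"
  using minimal by (auto simp: minimal_map_def)

lemma iter_in: "x \<in> X \<Longrightarrow> (f ^^ n) x \<in> X"
  by (induction n) (auto simp: f_in)

lemma continuous_iter: "continuous_on X (f ^^ n)"
proof (induction n)
  case (Suc n)
  have "continuous_on ((f ^^ n) ` X) f"
    by (rule continuous_on_subset[OF continuous_f]) (auto simp: iter_in)
  with Suc show ?case
    using continuous_on_compose[of X "f ^^ n" f] by (simp add: comp_def)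
qed auto

lemma subcontinuum_iter:
  assumes "subcontinuum K X"
  shows "subcontinuum ((f ^^ n) ` K) X"
proof -
  have "continuous_on K (f ^^ n)"
    using assms continuous_on_subset[OF continuous_iter] by (auto simp: subcontinuum_def)
  then show ?thesis
    using assms iter_in unfolding subcontinuum_def continuum_def
    by (auto intro!: compact_continuous_image connected_continuous_image)
qed

lemma invariant_closed:
  assumes "closed M" "M \<noteq> {}" "M \<subseteq> X" "f ` M \<subseteq> M"
  shows "M = X"
proof (rule ccontr)
  assume "M \<noteq> X"
  then have "M \<subset> X"
    using assms by blast
  then show False
    using minimal assms closed_subset[OF assms(3,1)] unfolding minimal_map_def by metis
qed

lemma surj_f: "f ` X = X"
proof (rule invariant_closed)
  show "closed (f ` X)"
    using compact_X continuous_f compact_continuous_image compact_imp_closed by blast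
qed (use nonempty_X f_in in auto)

lemma surj_iter: "(f ^^ n) ` X = X"
proof (induction n)
  case (Suc n)
  have "(f ^^ Suc n) ` X = f ` ((f ^^ n) ` X)"
    by auto
  then show ?case
    using Suc surj_f by simp
qed auto

text \<open>The closure of an orbit tail is forward invariant, so minimality makes it all of
  \<open>X\<close>. This lets a closed condition on \<open>X\<close> be checked along the tail of a
  single orbit.\<close>

lemma tail_dense:
  assumes "x \<in> X" "closed C" "\<And>n. n \<ge> m \<Longrightarrow> (f ^^ n) x \<in> C"
  shows "X \<subseteq> C"
proof -
  define T where "T = (\<lambda>n. (f ^^ (m + n)) x) ` UNIV"
  have TX: "closure T \<subseteq> X"
    using assms(1) compact_X by (intro closure_minimal) (auto simp: T_def iter_in compact_imp_closed)
  have "f ` T \<subseteq> T"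
  proof
    fix y assume "y \<in> f ` T"
    then obtain n where "y = f ((f ^^ (m + n)) x)"
      by (auto simp: T_def)
    then have "y = (f ^^ (m + Suc n)) x"
      by simp
    then show "y \<in> T"
      unfolding T_def by blast
  qed
  then have "f ` closure T \<subseteq> closure T"
    using TX closure_subset[of T]
    by (intro image_closure_subset continuous_on_subset[OF continuous_f]) auto
  then have "closure T = X"
    using TX by (intro invariant_closed) (auto simp: T_def)
  moreover have "closure T \<subseteq> C"
    using assms by (intro closure_minimal) (auto simp: T_def)
  ultimately show ?thesis by simp
qed

text \<open>A periodic orbit is finite, hence closed, and by minimality it would be all of
  \<open>X\<close>. A finite connected space is a single point, which nondegeneracy
  excludes.\<close>

lemma no_periodic:
  assumes "x \<in> X" "p \<ge> 1" "(f ^^ p) x = x"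
  shows False
proof -
  have per: "(f ^^ (p * k)) x = x" for k
    by (induction k) (auto simp: funpow_add assms(3))
  have "(f ^^ n) x \<in> (\<lambda>i. (f ^^ i) x) ` {..<p}" for n
  proof -
    have "(f ^^ n) x = (f ^^ (n mod p)) ((f ^^ (p * (n div p))) x)"
      by (metis comp_apply funpow_add add.commute mult_div_mod_eq)
    then show ?thesis
      using per assms(2) by simp
  qed
  then have "X \<subseteq> (\<lambda>i. (f ^^ i) x) ` {..<p}"
    using assms(1) by (intro tail_dense[of x _ 0]) (auto intro!: finite_imp_closed)
  then have "finite X"
    using finite_surj by blast
  then have "X = {} \<or> (\<exists>a. X = {a})"
    using connected_finite_iff_sing connected_X by blast
  then show False
    using nonempty_X nondegenerate by (auto simp: is_singleton_def)
qed

lemma open_preimage: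
  assumes "openin (top_of_set X) V"
  shows "openin (top_of_set X) {x \<in> X. (f ^^ n) x \<in> V}"
proof -
  have "openin (top_of_set X) (X \<inter> (f ^^ n) -` V)"
    using continuous_openin_preimage[OF continuous_iter, of n X V] assms iter_in by blast
  then show ?thesis
    by (simp add: Int_def vimage_def)
qed

lemma preimage_nonempty:
  assumes "openin (top_of_set X) V" "V \<noteq> {}"
  shows "{x \<in> X. (f ^^ n) x \<in> V} \<noteq> {}"
proof -
  obtain v where "v \<in> V" "v \<in> X"
    using assms openin_imp_subset by blast
  then show ?thesis
    using surj_iter[of n] by (metis (mono_tags, lifting) empty_iff imageE mem_Collect_eq)
qed

section \<open>Hitting times of open sets under weak mixing\<close>

definition hits :: "'a set \<Rightarrow> 'a set \<Rightarrow> nat \<Rightarrow> bool"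
  where "hits U V n \<longleftrightarrow> (\<exists>x\<in>U. (f ^^ n) x \<in> V)"

lemma hits_pair:
  assumes "openin (top_of_set X) U" "U \<noteq> {}" "openin (top_of_set X) V" "V \<noteq> {}"
    "openin (top_of_set X) U'" "U' \<noteq> {}" "openin (top_of_set X) V'" "V' \<noteq> {}"
  obtains n where "n \<ge> 1" "hits U V n" "hits U' V' n"
proof -
  have "openin (top_of_set (X \<times> X)) (U \<times> U')" "openin (top_of_set (X \<times> X)) (V \<times> V')"
    using assms by (auto intro: openin_Times)
  moreover have "U \<times> U' \<noteq> {}" "V \<times> V' \<noteq> {}"
    using assms by auto
  ultimately obtain n where n: "n \<ge> 1" "(map_prod f f ^^ n) ` (U \<times> U') \<inter> (V \<times> V') \<noteq> {}"
    using mixing[unfolded weakly_mixing_def transitive_system_def, rule_format, of "U \<times> U'" "V \<times> V'"]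
    by metis
  from n(2) have "hits U V n" "hits U' V' n"
    by (auto simp: map_prod_funpow hits_def)
  with n(1) show thesis
    using that by blast
qed

text \<open>Furstenberg's intersection argument: one \<open>n\<close> carries a part of
  \<open>U\<close> into \<open>U'\<close> and a part of \<open>V\<close> into \<open>V'\<close>.
  Since iterates commute, a hitting time between these parts is also one from \<open>U'\<close> to
  \<open>V'\<close>.\<close>

lemma hits_inter:
  assumes "openin (top_of_set X) U" "U \<noteq> {}" "openin (top_of_set X) V" "V \<noteq> {}"
    "openin (top_of_set X) U'" "U' \<noteq> {}" "openin (top_of_set X) V'" "V' \<noteq> {}"
  shows "\<exists>U'' V''. openin (top_of_set X) U'' \<and> U'' \<noteq> {} \<and> openin (top_of_set X) V'' \<and> V'' \<noteq> {} \<and>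
    (\<forall>n. hits U'' V'' n \<longrightarrow> hits U V n \<and> hits U' V' n)"
proof -
  obtain n where n: "hits U U' n" "hits V V' n"
    using hits_pair[OF assms(1,2,5,6,3,4,7,8)] by blast
  define U'' where "U'' = U \<inter> {x \<in> X. (f ^^ n) x \<in> U'}"
  define V'' where "V'' = V \<inter> {x \<in> X. (f ^^ n) x \<in> V'}"
  have "U \<subseteq> X" "V \<subseteq> X"
    using assms openin_imp_subset by blast+
  then have "U'' \<noteq> {}" "V'' \<noteq> {}"
    using n by (auto simp: U''_def V''_def hits_def)
  moreover have "openin (top_of_set X) U''" "openin (top_of_set X) V''"
    unfolding U''_def V''_def by (intro openin_Int assms open_preimage)+
  moreover have "hits U V k \<and> hits U' V' k" if k: "hits U'' V'' k" for k
  proof -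
    obtain x where x: "x \<in> U''" "(f ^^ k) x \<in> V''"
      using k by (auto simp: hits_def)
    have "(f ^^ k) ((f ^^ n) x) = (f ^^ n) ((f ^^ k) x)"
      by (metis add.commute comp_apply funpow_add)
    then have "(f ^^ n) x \<in> U'" "(f ^^ k) ((f ^^ n) x) \<in> V'"
      using x by (auto simp: U''_def V''_def)
    moreover have "x \<in> U" "(f ^^ k) x \<in> V"
      using x by (auto simp: U''_def V''_def)
    ultimately show ?thesis
      unfolding hits_def by blast
  qed
  ultimately show ?thesis
    by blast
qed

text \<open>If \<open>k\<close> hits the preimage of \<open>V\<close> under \<open>f ^^ i\<close>,
  then \<open>k + i\<close> hits \<open>V\<close>. These preimages are non-empty by surjectivity, so
  \<open>hits_inter\<close> provides a common \<open>k\<close> for all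
  \<open>i \<le> l\<close>.\<close>

lemma hits_thick:
  assumes "openin (top_of_set X) U" "U \<noteq> {}" "openin (top_of_set X) V" "V \<noteq> {}"
  obtains k where "k \<ge> 1" "\<And>i. i \<le> l \<Longrightarrow> hits U V (k + i)"
proof -
  have "\<exists>U' V'. openin (top_of_set X) U' \<and> U' \<noteq> {} \<and> openin (top_of_set X) V' \<and> V' \<noteq> {} \<and>
      (\<forall>k. hits U' V' k \<longrightarrow> (\<forall>i\<le>l. hits U V (k + i)))"
  proof (induction l)
    case 0
    then show ?case
      using assms by auto
  next
    case (Suc l)
    then obtain U' V' where UV: "openin (top_of_set X) U'" "U' \<noteq> {}" "openin (top_of_set X) V'" "V' \<noteq> {}"
      "\<And>k. hits U' V' k \<Longrightarrow> \<forall>i\<le>l. hits U V (k + i)"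
      by blast
    let ?V = "{x \<in> X. (f ^^ Suc l) x \<in> V}"
    obtain U'' V'' where UV'': "openin (top_of_set X) U''" "U'' \<noteq> {}" "openin (top_of_set X) V''" "V'' \<noteq> {}"
      "\<And>k. hits U'' V'' k \<Longrightarrow> hits U' V' k \<and> hits U ?V k"
      using hits_inter[OF UV(1-4) assms(1,2) open_preimage[OF assms(3)] preimage_nonempty[OF assms(3,4)]]
      by blast
    have "hits U V (k + Suc l)" if "hits U ?V k" for k
      using that by (auto simp: hits_def funpow_add add.commute[of k])
    then have "\<forall>i\<le>Suc l. hits U V (k + i)" if "hits U'' V'' k" for k
      using UV(5)[of k] UV''(5)[OF that] by (auto simp: le_Suc_eq)
    then show ?case
      using UV''(1-4) by (intro exI[of _ U''] exI[of _ V'']) simp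
  qed
  then obtain U' V' where UV: "openin (top_of_set X) U'" "U' \<noteq> {}" "openin (top_of_set X) V'" "V' \<noteq> {}"
      "\<And>k. hits U' V' k \<Longrightarrow> \<forall>i\<le>l. hits U V (k + i)"
    by blast
  then obtain k where "k \<ge> 1" "hits U' V' k"
    using hits_pair[OF UV(1-4) UV(1-4)] by blast
  then show thesis
    using UV(5) that by blast
qed

lemma hits_difference_sequence:
  assumes "openin (top_of_set X) U" "U \<noteq> {}" "openin (top_of_set X) V" "V \<noteq> {}"
  shows "\<exists>s::nat \<Rightarrow> nat. strict_mono s \<and> m \<le> s 0 \<and> (\<forall>i j. i < j \<longrightarrow> hits U V (s j - s i))"
proof -
  have "\<exists>k\<ge>1. \<forall>i\<le>l. hits U V (k + i)" for l
    using hits_thick[OF assms, of l] by blast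
  then obtain \<kappa> where \<kappa>: "\<And>l. \<kappa> l \<ge> 1" "\<And>l i. i \<le> l \<Longrightarrow> hits U V (\<kappa> l + i)"
    by metis
  \<comment> \<open>After the term \<open>t\<close> comes a run of hitting times from
    \<open>\<kappa> t\<close> to \<open>\<kappa> t + t\<close>. It contains the difference of the
    new term \<open>\<kappa> t + t\<close> with every term up to \<open>t\<close>, as these
    differences exceed \<open>\<kappa> t\<close> by at most \<open>t\<close>.\<close>
  define s where "s = rec_nat m (\<lambda>_ t. \<kappa> t + t)"
  have s: "s 0 = m" "s (Suc i) = \<kappa> (s i) + s i" for i
    by (simp_all add: s_def)
  have mono: "strict_mono s"
    unfolding strict_mono_Suc_iff using \<kappa>(1) by (auto simp: s Suc_le_eq)
  moreover have "hits U V (s j - s i)" if "i < j" for i j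
  proof -
    obtain j' where j': "j = Suc j'" "i \<le> j'"
      using \<open>i < j\<close> by (cases j) auto
    then have "s i \<le> s j'"
      using mono strict_mono_less_eq by blast
    then have "s j - s i = \<kappa> (s j') + (s j' - s i)"
      by (simp add: j' s)
    then show ?thesis
      using \<kappa>(2) by simp
  qed
  ultimately show ?thesis
    using s(1) by (intro exI[of _ s]) simp
qed

section \<open>Asymptotic sets and the absence of shrinking returns\<close>

definition asymptotic :: "'a set \<Rightarrow> bool"
  where "asymptotic K \<longleftrightarrow> (\<forall>\<epsilon>>0. \<forall>\<^sub>F n in sequentially. \<forall>x\<in>K. \<forall>y\<in>K. dist ((f ^^ n) x) ((f ^^ n) y) < \<epsilon>)"

lemma compact_limit:
  assumes "\<And>n::nat. u n \<in> X"
  obtains z r where "z \<in> X" "strict_mono (r :: nat \<Rightarrow> nat)" "(\<lambda>n. u (r n)) \<longlonglongrightarrow> z"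
proof -
  obtain z r where "z \<in> X" "strict_mono r" "(u \<circ> r) \<longlonglongrightarrow> z"
    using compact_X[unfolded compact_def, rule_format, of u] assms by blast
  then show thesis
    using that by (simp add: comp_def)
qed

text \<open>If iterates of \<open>K\<close> shrink along a subsequence, they cannot meet their own \<open>p\<close>-th image
  without creating a point of period \<open>p\<close>.\<close>

lemma not_recurrent_if_shrinking:
  assumes K: "K \<subseteq> X" and "p \<ge> 1"
    and meet: "\<And>n. n \<ge> m \<Longrightarrow> (f ^^ n) ` K \<inter> (f ^^ (n + p)) ` K \<noteq> {}"
    and small: "\<And>c n0. c > 0 \<Longrightarrow> \<exists>n\<ge>n0. \<forall>x\<in>K. \<forall>y\<in>K. dist ((f ^^ n) x) ((f ^^ n) y) < c"
  shows False
proof -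
  have "\<exists>n\<ge>m. \<forall>x\<in>K. \<forall>y\<in>K. dist ((f ^^ n) x) ((f ^^ n) y) < inverse (real (Suc k))" for k
    by (rule small) simp
  then obtain \<nu> where \<nu>: "\<And>k. \<nu> k \<ge> m"
    "\<And>k x y. x \<in> K \<Longrightarrow> y \<in> K \<Longrightarrow> dist ((f ^^ \<nu> k) x) ((f ^^ \<nu> k) y) < inverse (real (Suc k))"
    by metis
  have "\<exists>x y. x \<in> K \<and> y \<in> K \<and> (f ^^ \<nu> k) x = (f ^^ p) ((f ^^ \<nu> k) y)" for k
    using meet[OF \<nu>(1), of k] by (auto simp: funpow_add add.commute[of _ p])
  then obtain a b where ab: "\<And>k. a k \<in> K" "\<And>k. b k \<in> K" "\<And>k. (f ^^ \<nu> k) (a k) = (f ^^ p) ((f ^^ \<nu> k) (b k))"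
    by metis
  \<comment> \<open>Both points lie in the same shrinking iterate, so they have a common limit along
    a subsequence. As \<open>f ^^ p\<close> takes \<open>v k\<close> to \<open>u k\<close>, this
    limit has period \<open>p\<close>.\<close>
  define u v where "u k = (f ^^ \<nu> k) (a k)" and "v k = (f ^^ \<nu> k) (b k)" for k
  have uX: "u k \<in> X" "v k \<in> X" for k
    using ab(1,2)[of k] K unfolding u_def v_def by (auto intro!: iter_in)
  obtain z r where z: "z \<in> X" "strict_mono r" "(\<lambda>k. u (r k)) \<longlonglongrightarrow> z"
    by (rule compact_limit[of u]) (use uX in auto)
  have "(\<lambda>k. dist (u k) (v k)) \<longlonglongrightarrow> 0"
  proof (rule Lim_null_comparison)
    have "norm (dist (u k) (v k)) \<le> inverse (real (Suc k))" for k
      using \<nu>(2)[OF ab(1,2)[of k], of k] by (simp add: u_def v_def)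
    then show "\<forall>\<^sub>F k in sequentially. norm (dist (u k) (v k)) \<le> inverse (real (Suc k))"
      by (intro always_eventually) simp
  qed (rule LIMSEQ_inverse_real_of_nat)
  then have "(\<lambda>k. dist (u (r k)) (v (r k))) \<longlonglongrightarrow> 0"
    using LIMSEQ_subseq_LIMSEQ[OF _ z(2)] by (auto simp: comp_def)
  moreover have "(\<lambda>k. dist (u (r k)) z) \<longlonglongrightarrow> 0"
    using z(3) by (simp add: tendsto_dist_iff[symmetric])
  ultimately have "(\<lambda>k. dist (u (r k)) (v (r k)) + dist (u (r k)) z) \<longlonglongrightarrow> 0 + 0"
    by (rule tendsto_add)
  then have sum0: "(\<lambda>k. dist (u (r k)) (v (r k)) + dist (u (r k)) z) \<longlonglongrightarrow> 0"
    by simp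
  have "(\<lambda>k. dist (v (r k)) z) \<longlonglongrightarrow> 0"
    by (rule Lim_null_comparison[OF _ sum0]) (auto intro!: always_eventually dist_triangle3)
  then have v: "(\<lambda>k. v (r k)) \<longlonglongrightarrow> z"
    by (simp add: tendsto_dist_iff[symmetric])
  have "(\<lambda>k. (f ^^ p) (v (r k))) \<longlonglongrightarrow> (f ^^ p) z"
    using continuous_on_tendsto_compose[OF continuous_iter v z(1)] uX by simp
  moreover have "(f ^^ p) (v (r k)) = u (r k)" for k
    using ab by (simp add: u_def v_def)
  ultimately have "(f ^^ p) z = z"
    using z(3) LIMSEQ_unique by auto
  then show False
    using no_periodic z(1) \<open>p \<ge> 1\<close> by blast
qed

lemma subcontinuum_subset: "subcontinuum K X \<Longrightarrow> K \<subseteq> X"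
  by (simp add: subcontinuum_def)

lemma subcontinuum_nonempty: "subcontinuum K X \<Longrightarrow> K \<noteq> {}"
  by (simp add: subcontinuum_def continuum_def)

lemma iter_meet_mono:
  assumes "(f ^^ n) ` K \<inter> (f ^^ (n + d)) ` K \<noteq> {}" "n \<le> k"
  shows "(f ^^ k) ` K \<inter> (f ^^ (k + d)) ` K \<noteq> {}"
proof -
  obtain x y where "x \<in> K" "y \<in> K" and xy: "(f ^^ n) x = (f ^^ (n + d)) y"
    using assms(1) by blast
  have "(f ^^ k) x = (f ^^ (k - n)) ((f ^^ n) x)"
    using assms(2) by (metis comp_apply funpow_add le_add_diff_inverse2)
  also have "\<dots> = (f ^^ (k - n + (n + d))) y"
    by (simp only: xy funpow_add comp_apply)
  also have "k - n + (n + d) = k + d"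
    using assms(2) by simp
  finally show ?thesis
    using \<open>x \<in> K\<close> \<open>y \<in> K\<close> by (metis IntI empty_iff imageI)
qed

lemma asymptotic_singleton: "asymptotic {x}"
  by (simp add: asymptotic_def)

lemma asymptotic_Un:
  assumes "asymptotic K" "asymptotic L" "K \<inter> L \<noteq> {}"
  shows "asymptotic (K \<union> L)"
  unfolding asymptotic_def
proof (intro allI impI)
  fix \<epsilon> :: real assume "\<epsilon> > 0"
  obtain z where z: "z \<in> K" "z \<in> L"
    using assms(3) by blast
  have "\<forall>\<^sub>F n in sequentially. \<forall>x\<in>K. \<forall>y\<in>K. dist ((f ^^ n) x) ((f ^^ n) y) < \<epsilon> / 2"
    "\<forall>\<^sub>F n in sequentially. \<forall>x\<in>L. \<forall>y\<in>L. dist ((f ^^ n) x) ((f ^^ n) y) < \<epsilon> / 2"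
    using assms(1,2) half_gt_zero[OF \<open>\<epsilon> > 0\<close>] unfolding asymptotic_def by blast+
  then show "\<forall>\<^sub>F n in sequentially. \<forall>x\<in>K \<union> L. \<forall>y\<in>K \<union> L. dist ((f ^^ n) x) ((f ^^ n) y) < \<epsilon>"
  proof eventually_elim
    case (elim n)
    have "dist ((f ^^ n) x) ((f ^^ n) z) < \<epsilon> / 2" if "x \<in> K \<union> L" for x
      using elim z that by blast
    then show ?case
      by (meson dist_triangle_half_l)
  qed
qed

lemma asymptotic_iter_iff: "asymptotic ((f ^^ m) ` K) \<longleftrightarrow> asymptotic K"
proof -
  let ?P = "\<lambda>\<epsilon> n. \<forall>x\<in>K. \<forall>y\<in>K. dist ((f ^^ n) x) ((f ^^ n) y) < \<epsilon>"
  have "(\<forall>x\<in>(f ^^ m) ` K. \<forall>y\<in>(f ^^ m) ` K. dist ((f ^^ n) x) ((f ^^ n) y) < \<epsilon>) \<longleftrightarrow> ?P \<epsilon> (n + m)" for n \<epsilon>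
    by (simp add: funpow_add)
  moreover have "(\<forall>\<^sub>F n in sequentially. ?P \<epsilon> (n + m)) \<longleftrightarrow> eventually (?P \<epsilon>) sequentially" for \<epsilon>
    by (rule eventually_sequentially_seg)
  ultimately show ?thesis
    unfolding asymptotic_def by presburger
qed

end

subsection \<open>Asymptotic continua\<close>

locale suslinean_mixing = minimal_weakly_mixing +
  assumes suslinean: "finitely_suslinean X"
begin

text \<open>The iterates are pairwise disjoint subcontinua, so only finitely many of them contain
  two points at distance at least \<open>\<epsilon>\<close>.\<close>

lemma wandering_imp_asymptotic:
  assumes K: "subcontinuum K X"
    and disj: "\<And>m p. p \<ge> 1 \<Longrightarrow> (f ^^ m) ` K \<inter> (f ^^ (m + p)) ` K = {}"
  shows "asymptotic K"
  unfolding asymptotic_def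
proof (intro allI impI)
  fix \<epsilon> :: real assume "\<epsilon> > 0"
  define N where "N = {n. \<exists>x\<in>K. \<exists>y\<in>K. \<epsilon> \<le> dist ((f ^^ n) x) ((f ^^ n) y)}"
  have disj': "(f ^^ i) ` K \<inter> (f ^^ j) ` K = {}" if "i \<noteq> j" for i j
    using that
  proof (induction i j rule: linorder_wlog)
    case (le i j)
    then show ?case
      using disj[of "j - i" i] by simp
  qed (simp add: Int_commute)
  have "finite N"
    by (rule finitely_suslinean_finite_index[OF suslinean \<open>\<epsilon> > 0\<close>, of N "\<lambda>n. (f ^^ n) ` K"])
      (use subcontinuum_iter[OF K] disj' in \<open>auto simp: N_def\<close>)
  then have "\<forall>\<^sub>F n in sequentially. n \<notin> N"
    by (metis (no_types, lifting) eventually_sequentially finite_nat_set_iff_bounded not_le)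
  then show "\<forall>\<^sub>F n in sequentially. \<forall>x\<in>K. \<forall>y\<in>K. dist ((f ^^ n) x) ((f ^^ n) y) < \<epsilon>"
    by (rule eventually_mono) (auto simp: N_def not_le)
qed

text \<open>By \<open>wandering_imp_asymptotic\<close> some iterate of \<open>K\<close> meets its
  \<open>p\<close>-th image, and all later ones inherit this. Arbitrarily small late iterates would
  then yield a periodic point.\<close>

lemma not_asymptotic_bounded_below:
  assumes K: "subcontinuum K X" and "\<not> asymptotic K"
  shows "\<exists>c>0. \<exists>n0. \<forall>n\<ge>n0. \<exists>x\<in>K. \<exists>y\<in>K. c \<le> dist ((f ^^ n) x) ((f ^^ n) y)"
proof (rule ccontr)
  assume "\<not> ?thesis"
  then have small: "\<exists>n\<ge>n0. \<forall>x\<in>K. \<forall>y\<in>K. dist ((f ^^ n) x) ((f ^^ n) y) < c" if "c > 0" for c n0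
    using that by (meson not_le)
  obtain m p where mp: "p \<ge> 1" "(f ^^ m) ` K \<inter> (f ^^ (m + p)) ` K \<noteq> {}"
    using wandering_imp_asymptotic assms by blast
  show False
    by (rule not_recurrent_if_shrinking[OF subcontinuum_subset[OF K] mp(1) iter_meet_mono[OF mp(2)] small])
qed

text \<open>If a non-asymptotic \<open>K\<close> stayed \<open>\<delta>\<close>-small after applying \<open>\<Phi>\<close>, then every \<open>d\<close> for which
  some \<open>f\<^sup>n(K)\<close> meets \<open>f\<^sup>n\<^sup>+\<^sup>d(K)\<close> would move all points by at most \<open>2\<delta>\<close>. Such \<open>d\<close> meet every
  difference set, because infinitely many large continua cannot be disjoint, while the hitting times
  of two open sets contain one.\<close>

lemma stable_imp_asymptotic:
  fixes \<Phi> :: "'a \<Rightarrow> 'b::metric_space"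
  assumes K: "subcontinuum K X" and \<Phi>: "continuous_on X \<Phi>"
    and ab: "a \<in> X" "b \<in> X" "2 * \<delta> < dist (\<Phi> a) (\<Phi> b)"
    and small: "\<And>n x y. n \<ge> n1 \<Longrightarrow> x \<in> K \<Longrightarrow> y \<in> K \<Longrightarrow> dist (\<Phi> ((f ^^ n) x)) (\<Phi> ((f ^^ n) y)) \<le> \<delta>"
  shows "asymptotic K"
proof (rule ccontr)
  assume "\<not> asymptotic K"
  then obtain c n0 where c: "c > 0" "\<And>n. n \<ge> n0 \<Longrightarrow> \<exists>x\<in>K. \<exists>y\<in>K. c \<le> dist ((f ^^ n) x) ((f ^^ n) y)"
    using not_asymptotic_bounded_below[OF K] by blast
  \<comment> \<open>With this radius \<open>2 * \<delta> + 2 * \<theta>\<close> is exactly the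
    distance of \<open>\<Phi> a\<close> and \<open>\<Phi> b\<close>, so points of \<open>U\<close>
    and \<open>V\<close> have images more than \<open>2 * \<delta>\<close> apart.\<close>
  define \<theta> where "\<theta> = (dist (\<Phi> a) (\<Phi> b) - 2 * \<delta>) / 2"
  define U where "U = X \<inter> \<Phi> -` ball (\<Phi> a) \<theta>"
  define V where "V = X \<inter> \<Phi> -` ball (\<Phi> b) \<theta>"
  have "\<theta> > 0"
    using ab by (simp add: \<theta>_def)
  have UV: "openin (top_of_set X) U" "U \<noteq> {}" "openin (top_of_set X) V" "V \<noteq> {}"
    unfolding U_def V_def using ab \<open>\<theta> > 0\<close> \<Phi> by (auto intro!: continuous_openin_preimage_gen)
  \<comment> \<open>Starting beyond \<open>n0\<close> and \<open>n1\<close> puts both bounds in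
    force for every \<open>f ^^ s i\<close>: \<open>c\<close> from below and \<open>\<delta>\<close>
    from above.\<close>
  from hits_difference_sequence[OF UV, of "max n0 n1"] obtain s :: "nat \<Rightarrow> nat"
    where "strict_mono s \<and> max n0 n1 \<le> s 0 \<and> (\<forall>i j. i < j \<longrightarrow> hits U V (s j - s i))" ..
  then have s: "strict_mono s" "max n0 n1 \<le> s 0" "\<And>i j. i < j \<Longrightarrow> hits U V (s j - s i)"
    by simp_all
  have s_ge: "s i \<ge> max n0 n1" for i
    using s(1,2) by (meson le_trans le0 strict_mono_less_eq)
  have "\<exists>i j. i < j \<and> (f ^^ s i) ` K \<inter> (f ^^ s j) ` K \<noteq> {}"
  proof (rule ccontr)
    assume "\<not> ?thesis"
    then have disj: "(f ^^ s i) ` K \<inter> (f ^^ s j) ` K = {}" if "i \<noteq> j" for i j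
      using that by (metis Int_commute nat_neq_iff)
    have "\<exists>x\<in>(f ^^ s i) ` K. \<exists>y\<in>(f ^^ s i) ` K. c \<le> dist x y" for i
      using c(2)[of "s i"] s_ge[of i] by auto
    then have "finite (UNIV :: nat set)"
      using subcontinuum_iter[OF K] disj
      by (intro finitely_suslinean_finite_index[OF suslinean c(1), of UNIV "\<lambda>i. (f ^^ s i) ` K"]) auto
    then show False
      by simp
  qed
  then obtain i j where ij: "i < j" "(f ^^ s i) ` K \<inter> (f ^^ s j) ` K \<noteq> {}"
    by blast
  define d where "d = s j - s i"
  have d: "s j = s i + d"
    using ij(1) s(1) by (simp add: d_def strict_mono_less less_imp_le)
  obtain x0 where x0: "x0 \<in> K"
    using subcontinuum_nonempty[OF K] by blast
  have close: "dist (\<Phi> ((f ^^ n) x0)) (\<Phi> ((f ^^ d) ((f ^^ n) x0))) \<le> 2 * \<delta>" if n: "n \<ge> s i" for n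
  proof -
    obtain x y where xy: "x \<in> K" "y \<in> K" "(f ^^ n) x = (f ^^ (n + d)) y"
      using iter_meet_mono[OF ij(2)[unfolded d] n] by blast
    have n1: "n \<ge> n1" "n + d \<ge> n1"
      using n s_ge[of i] by auto
    have "dist (\<Phi> ((f ^^ n) x0)) (\<Phi> ((f ^^ (n + d)) x0)) \<le> 2 * \<delta>"
      using dist_triangle[of "\<Phi> ((f ^^ n) x0)" "\<Phi> ((f ^^ (n + d)) x0)" "\<Phi> ((f ^^ n) x)"]
        small[OF n1(1) x0 xy(1)] small[OF n1(2) xy(2) x0] xy(3) by simp
    then show ?thesis
      by (simp add: funpow_add add.commute[of n])
  qed
  \<comment> \<open>The estimate along the tail of the orbit of \<open>x0\<close> is a closed
    condition, so \<open>tail_dense\<close> extends it to all of \<open>X\<close>, in particular to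
    a point of \<open>U\<close> that \<open>f ^^ d\<close> sends into \<open>V\<close>.\<close>
  define C where "C = {y \<in> X. dist (\<Phi> y) (\<Phi> ((f ^^ d) y)) \<le> 2 * \<delta>}"
  have cont: "continuous_on X (\<lambda>y. dist (\<Phi> y) (\<Phi> ((f ^^ d) y)))"
  proof (intro continuous_on_dist \<Phi>)
    show "continuous_on X (\<lambda>y. \<Phi> ((f ^^ d) y))"
      by (rule continuous_on_compose2[OF \<Phi> continuous_iter]) (auto simp: iter_in)
  qed
  have "closed C"
    unfolding C_def using compact_imp_closed[OF compact_X] cont
    by (intro continuous_on_closed_Collect_le) auto
  moreover have "x0 \<in> X"
    using x0 subcontinuum_subset[OF K] by blast
  ultimately have "X \<subseteq> C"
    using close iter_in by (intro tail_dense[of x0 C "s i"]) (auto simp: C_def)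
  obtain u where u: "u \<in> U" "(f ^^ d) u \<in> V"
    using s(3)[OF ij(1)] by (auto simp: d_def hits_def)
  then have "dist (\<Phi> u) (\<Phi> ((f ^^ d) u)) \<le> 2 * \<delta>" "dist (\<Phi> a) (\<Phi> u) < \<theta>" "dist (\<Phi> b) (\<Phi> ((f ^^ d) u)) < \<theta>"
    using \<open>X \<subseteq> C\<close> by (auto simp: C_def U_def V_def)
  then have "dist (\<Phi> a) (\<Phi> b) < 2 * \<delta> + 2 * \<theta>"
    using dist_triangle[of "\<Phi> a" "\<Phi> b" "\<Phi> u"] dist_triangle[of "\<Phi> u" "\<Phi> b" "\<Phi> ((f ^^ d) u)"]
    by (simp add: dist_commute)
  then show False
    by (simp add: \<theta>_def field_simps)
qed

section \<open>The decomposition into asymptotic classes\<close>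

definition class_of :: "'a \<Rightarrow> 'a set"
  where "class_of x = \<Union>{K. subcontinuum K X \<and> asymptotic K \<and> x \<in> K}"

lemma in_class_of_iff: "y \<in> class_of x \<longleftrightarrow> (\<exists>K. subcontinuum K X \<and> asymptotic K \<and> x \<in> K \<and> y \<in> K)"
  by (auto simp: class_of_def)

lemma in_class_of_self: "x \<in> X \<Longrightarrow> x \<in> class_of x"
  unfolding in_class_of_iff
  by (rule exI[of _ "{x}"]) (simp add: asymptotic_singleton subcontinuum_def continuum_def)

lemma class_of_subset: "class_of x \<subseteq> X"
  by (auto simp: class_of_def subcontinuum_def)

lemma in_class_of_sym: "y \<in> class_of x \<Longrightarrow> x \<in> class_of y"
  by (auto simp: in_class_of_iff)

lemma in_class_of_trans:
  assumes "y \<in> class_of x" "z \<in> class_of y"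
  shows "z \<in> class_of x"
proof -
  obtain K L where KL: "subcontinuum K X" "asymptotic K" "x \<in> K" "y \<in> K"
    "subcontinuum L X" "asymptotic L" "y \<in> L" "z \<in> L"
    using assms unfolding in_class_of_iff by blast
  have "subcontinuum (K \<union> L) X"
    using KL by (auto simp: subcontinuum_def continuum_def intro!: connected_Un)
  moreover have "asymptotic (K \<union> L)"
    using KL by (intro asymptotic_Un) auto
  ultimately show ?thesis
    using KL unfolding in_class_of_iff by blast
qed

lemma class_of_eq: "y \<in> class_of x \<Longrightarrow> class_of y = class_of x"
  using in_class_of_sym in_class_of_trans by blast

lemma class_of_iter: "y \<in> class_of x \<Longrightarrow> (f ^^ n) y \<in> class_of ((f ^^ n) x)"
proof -
  assume "y \<in> class_of x"
  then obtain K where "subcontinuum K X" "asymptotic K" "x \<in> K" "y \<in> K"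
    unfolding in_class_of_iff by blast
  then have "subcontinuum ((f ^^ n) ` K) X" "asymptotic ((f ^^ n) ` K)"
    "(f ^^ n) x \<in> (f ^^ n) ` K" "(f ^^ n) y \<in> (f ^^ n) ` K"
    by (auto simp: subcontinuum_iter asymptotic_iter_iff)
  then show ?thesis
    unfolding in_class_of_iff by blast
qed

text \<open>Classes are not yet known to be closed, so each large one is represented by a
  subcontinuum inside it through two distant points. Distinct classes are disjoint, hence so are the
  representatives.\<close>

lemma finite_large_classes:
  assumes "\<epsilon> > 0"
  shows "finite {E \<in> class_of ` X. \<exists>u\<in>E. \<exists>v\<in>E. \<epsilon> \<le> dist u v}" (is "finite ?\<E>")
proof -
  let ?Q = "\<lambda>E K. subcontinuum K X \<and> K \<subseteq> E \<and> (\<exists>u\<in>K. \<exists>v\<in>K. \<epsilon> \<le> dist u v)"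
  have "\<exists>K. ?Q E K" if E: "E \<in> ?\<E>" for E
  proof -
    obtain x u v where xuv: "E = class_of x" "u \<in> E" "v \<in> E" "\<epsilon> \<le> dist u v"
      using E by blast
    then have "class_of u = E" "v \<in> class_of u"
      using class_of_eq by auto
    then obtain K where "subcontinuum K X" "asymptotic K" "u \<in> K" "v \<in> K"
      unfolding in_class_of_iff by blast
    moreover have "K \<subseteq> E"
      using calculation \<open>class_of u = E\<close> in_class_of_iff by blast
    ultimately show ?thesis
      using xuv(4) by blast
  qed
  then have "\<forall>E\<in>?\<E>. \<exists>K. ?Q E K"
    by (rule ballI)
  from bchoice[OF this] obtain \<kappa> where "\<forall>E\<in>?\<E>. ?Q E (\<kappa> E)" ..
  then have \<kappa>: "?Q E (\<kappa> E)" if "E \<in> ?\<E>" for E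
    using that by (rule bspec)
  have disj: "\<kappa> E \<inter> \<kappa> E' = {}" if E: "E \<in> ?\<E>" "E' \<in> ?\<E>" "E \<noteq> E'" for E E'
  proof (rule ccontr)
    assume "\<kappa> E \<inter> \<kappa> E' \<noteq> {}"
    then obtain z where "z \<in> E" "z \<in> E'"
      using \<kappa>[OF E(1)] \<kappa>[OF E(2)] by blast
    moreover obtain x x' where "E = class_of x" "E' = class_of x'"
      using E by blast
    ultimately have "E = class_of z" "E' = class_of z"
      using class_of_eq[of z x] class_of_eq[of z x'] by simp_all
    then show False
      using E(3) by simp
  qed
  show ?thesis
    by (rule finitely_suslinean_finite_index[OF suslinean assms, of _ \<kappa>]) (use \<kappa> disj in \<open>simp; fail\<close>)+
qed

text \<open>Otherwise some asymptotic \<open>K\<close> contains both \<open>y\<close> and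
  \<open>(f ^^ p) y\<close>. Its iterates would shrink while each meets its own \<open>p\<close>-th
  image.\<close>

lemma class_of_iterates_distinct:
  assumes "x \<in> X" "p \<ge> 1"
  shows "class_of ((f ^^ (n + p)) x) \<noteq> class_of ((f ^^ n) x)"
proof
  define y where "y = (f ^^ n) x"
  assume "class_of ((f ^^ (n + p)) x) = class_of ((f ^^ n) x)"
  then have "(f ^^ p) y \<in> class_of y"
    using in_class_of_self[OF iter_in[OF assms(1), of "n + p"]] by (simp add: y_def funpow_add add.commute[of n])
  then obtain K where K: "subcontinuum K X" "asymptotic K" "y \<in> K" "(f ^^ p) y \<in> K"
    unfolding in_class_of_iff by blast
  show False
  proof (rule not_recurrent_if_shrinking[OF subcontinuum_subset[OF K(1)] assms(2)])
    show "(f ^^ k) ` K \<inter> (f ^^ (k + p)) ` K \<noteq> {}" for k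
    proof -
      have "(f ^^ k) ((f ^^ p) y) = (f ^^ (k + p)) y"
        by (simp add: funpow_add)
      then show ?thesis
        using K(3,4) by (metis IntI empty_iff imageI)
    qed
    show "\<exists>n\<ge>n0. \<forall>x\<in>K. \<forall>y\<in>K. dist ((f ^^ n) x) ((f ^^ n) y) < c" if "c > 0" for c n0
      using K(2) that unfolding asymptotic_def eventually_sequentially by (meson nle_le)
  qed
qed

text \<open>The iterates of a class lie in pairwise different classes, of which only finitely many
  are large. Passing to the closure costs only the strictness of the bound, which working with
  \<open>\<epsilon> / 2\<close> absorbs.\<close>

lemma asymptotic_class_closure:
  assumes "x \<in> X"
  shows "asymptotic (closure (class_of x))"
  unfolding asymptotic_def
proof (intro allI impI)
  fix \<epsilon> :: real assume "\<epsilon> > 0"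
  let ?\<E> = "{E \<in> class_of ` X. \<exists>u\<in>E. \<exists>v\<in>E. \<epsilon> / 2 \<le> dist u v}"
  define N where "N = {n. class_of ((f ^^ n) x) \<in> ?\<E>}"
  have "finite ((\<lambda>n. class_of ((f ^^ n) x)) ` N)"
    using finite_large_classes[of "\<epsilon> / 2"] \<open>\<epsilon> > 0\<close> by (rule_tac finite_subset[of _ ?\<E>]) (auto simp: N_def)
  moreover have "inj_on (\<lambda>n. class_of ((f ^^ n) x)) N"
  proof (rule linorder_inj_onI)
    fix i j :: nat assume "i < j"
    then have "1 \<le> j - i" "i + (j - i) = j"
      by auto
    then show "class_of ((f ^^ i) x) \<noteq> class_of ((f ^^ j) x)"
      using class_of_iterates_distinct[OF assms, of "j - i" i] by metis
  qed auto
  ultimately have "finite N"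
    by (rule finite_imageD)
  then have "\<forall>\<^sub>F n in sequentially. n \<notin> N"
    by (metis (no_types, lifting) eventually_sequentially finite_nat_set_iff_bounded not_le)
  then show "\<forall>\<^sub>F n in sequentially. \<forall>u\<in>closure (class_of x). \<forall>v\<in>closure (class_of x).
      dist ((f ^^ n) u) ((f ^^ n) v) < \<epsilon>"
  proof (rule eventually_mono, intro ballI)
    fix n u v assume n: "n \<notin> N" and uv: "u \<in> closure (class_of x)" "v \<in> closure (class_of x)"
    have "closure (class_of x) \<subseteq> X"
      using class_of_subset compact_X by (intro closure_minimal) (auto simp: compact_imp_closed)
    then have "(f ^^ n) ` closure (class_of x) \<subseteq> closure ((f ^^ n) ` class_of x)"
      by (intro image_closure_subset continuous_on_subset[OF continuous_iter]) (auto intro: closure_subset[THEN subsetD])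
    moreover have "closure ((f ^^ n) ` class_of x) \<subseteq> closure (class_of ((f ^^ n) x))"
      using class_of_iter by (intro closure_mono) auto
    ultimately have uv': "(f ^^ n) u \<in> closure (class_of ((f ^^ n) x))" "(f ^^ n) v \<in> closure (class_of ((f ^^ n) x))"
      using uv by (meson imageI subsetD)+
    have "dist y z \<le> \<epsilon> / 2" if "y \<in> class_of ((f ^^ n) x)" "z \<in> class_of ((f ^^ n) x)" for y z
      using n iter_in[OF assms, of n] that by (fastforce simp: N_def)
    then have "dist ((f ^^ n) u) ((f ^^ n) v) \<le> \<epsilon> / 2"
      using uv' by (rule dist_le_closure)
    then show "dist ((f ^^ n) u) ((f ^^ n) v) < \<epsilon>"
      using \<open>\<epsilon> > 0\<close> by simp
  qed
qed

text \<open>The closure is itself an asymptotic subcontinuum through \<open>x\<close>, hence one of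
  the sets whose union is the class.\<close>

lemma closed_class_of:
  assumes "x \<in> X"
  shows "closed (class_of x)"
proof -
  have "closure (class_of x) \<subseteq> X"
    using class_of_subset compact_X by (intro closure_minimal) (auto simp: compact_imp_closed)
  moreover have "connected (class_of x)"
    unfolding class_of_def by (rule connected_Union) (auto simp: subcontinuum_def continuum_def)
  moreover have "x \<in> closure (class_of x)"
    using in_class_of_self[OF assms] closure_subset by blast
  moreover have "compact (closure (class_of x))"
    using compact_Int_closed[OF compact_X closed_closure, of "class_of x"] calculation(1) by (simp add: inf.absorb2)
  ultimately have "subcontinuum (closure (class_of x)) X"
    unfolding subcontinuum_def continuum_def by (auto intro: connected_imp_connected_closure)
  then have "closure (class_of x) \<subseteq> class_of x"
    using asymptotic_class_closure[OF assms] \<open>x \<in> closure (class_of x)\<close> in_class_of_iff by blast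
  then show ?thesis
    using closure_subset closure_closed by (metis closed_closure subset_antisym)
qed

text \<open>The classes form a null family, so the decomposition of \<open>X\<close> into them is upper semicontinuous.\<close>

lemma openin_class_of_subset:
  assumes W: "openin (top_of_set X) W"
  shows "openin (top_of_set X) {x \<in> X. class_of x \<subseteq> W}"
  unfolding openin_contains_ball
proof (intro conjI ballI)
  fix x assume x: "x \<in> {x \<in> X. class_of x \<subseteq> W}"
  then have "x \<in> W"
    using in_class_of_self by blast
  then obtain r where r: "r > 0" "ball x r \<inter> X \<subseteq> W"
    using W unfolding openin_contains_ball by blast
  \<comment> \<open>Only finitely many classes reach size \<open>r / 2\<close>. Those other than the
    class of \<open>x\<close> are closed and miss \<open>x\<close>, so a small ball avoids them. Any
    remaining class that meets this ball is too small to leave \<open>ball x r\<close>.\<close>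
  let ?\<E> = "{E \<in> class_of ` X. \<exists>u\<in>E. \<exists>v\<in>E. r / 2 \<le> dist u v}"
  have "finite ?\<E>"
    using r by (intro finite_large_classes) simp
  moreover have "closed E" if "E \<in> ?\<E> - {class_of x}" for E
    using that closed_class_of by blast
  ultimately have "closed (\<Union>(?\<E> - {class_of x}))"
    by (intro closed_Union) auto
  then have "open (- \<Union>(?\<E> - {class_of x}))"
    by (rule open_Compl)
  moreover have "x \<notin> \<Union>(?\<E> - {class_of x})"
    using class_of_eq by auto
  then have "x \<in> - \<Union>(?\<E> - {class_of x})"
    by (simp only: Compl_iff not_False_eq_True)
  ultimately obtain s where s: "s > 0" "ball x s \<subseteq> - \<Union>(?\<E> - {class_of x})"
    by (rule openE)
  have "class_of y \<subseteq> W" if y: "y \<in> ball x (min s (r / 2)) \<inter> X" for y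
  proof (cases "class_of y = class_of x")
    case False
    have "y \<in> class_of y" "y \<in> ball x s"
      using y in_class_of_self by auto
    then have "class_of y \<notin> ?\<E> - {class_of x}"
      using s(2) by blast
    then have "class_of y \<notin> ?\<E>"
      using False by simp
    then have near: "dist y z < r / 2" if "z \<in> class_of y" for z
      using y \<open>y \<in> class_of y\<close> that by (force simp: not_le)
    show ?thesis
    proof
      fix z assume z: "z \<in> class_of y"
      have "dist x z < r"
        using near[OF z] y dist_triangle[of x z y] by simp
      then show "z \<in> W"
        using r(2) class_of_subset[of y] z by auto
    qed
  qed (use x in simp)
  then have "ball x (min s (r / 2)) \<inter> X \<subseteq> {x \<in> X. class_of x \<subseteq> W}"
    by blast
  moreover have "min s (r / 2) > 0"
    using r(1) s(1) by simp
  ultimately show "\<exists>e>0. ball x e \<inter> X \<subseteq> {x \<in> X. class_of x \<subseteq> W}"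
    by blast
qed auto

text \<open>A single class would make all of \<open>X\<close> asymptotic, whereas every iterate of
  \<open>f\<close> maps \<open>X\<close> onto itself and so cannot shrink it.\<close>

lemma class_of_proper: "\<exists>b\<in>X. b \<notin> class_of a" if a: "a \<in> X"
proof (rule ccontr)
  assume "\<not> ?thesis"
  then have "class_of a = X"
    using class_of_subset by blast
  then have "asymptotic X"
    using asymptotic_class_closure[OF a] closed_class_of[OF a] by simp
  have "x = y" if xy: "x \<in> X" "y \<in> X" for x y
  proof (rule ccontr)
    assume "x \<noteq> y"
    then have "\<forall>\<^sub>F n in sequentially. \<forall>u\<in>X. \<forall>v\<in>X. dist ((f ^^ n) u) ((f ^^ n) v) < dist x y"
      using \<open>asymptotic X\<close> unfolding asymptotic_def by simp
    then obtain n where n: "\<forall>u\<in>X. \<forall>v\<in>X. dist ((f ^^ n) u) ((f ^^ n) v) < dist x y"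
      using eventually_happens'[OF sequentially_bot] by blast
    moreover have "x \<in> (f ^^ n) ` X" "y \<in> (f ^^ n) ` X"
      using surj_iter[of n] xy by simp_all
    ultimately show False
      by blast
  qed
  then have "X = {a}"
    using a by blast
  then show False
    using nondegenerate by simp
qed

text \<open>Urysohn's lemma is applied on \<open>X\<close> with the topology of saturated open sets,
  which stands in for the quotient by the classes. Upper semicontinuity of the decomposition makes
  this topology normal.\<close>

lemma exists_class_function:
  obtains g :: "'a \<Rightarrow> real" and a b
  where "continuous_on X g" "\<And>x y. x \<in> X \<Longrightarrow> y \<in> class_of x \<Longrightarrow> g y = g x"
    "a \<in> X" "b \<in> X" "g a \<noteq> g b"
proof -
  define Q where "Q U \<longleftrightarrow> openin (top_of_set X) U \<and> (\<forall>x\<in>U. class_of x \<subseteq> U)" for U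
  define \<tau> where "\<tau> = topology Q"
  have "istopology Q"
    unfolding istopology_def
  proof (intro conjI allI impI)
    show "Q (S \<inter> T)" if "Q S" "Q T" for S T
      using that by (auto simp: Q_def)
    show "Q (\<Union>\<K>)" if "\<forall>K\<in>\<K>. Q K" for \<K>
      using that unfolding Q_def by (intro conjI openin_Union) blast+
  qed
  then have \<tau>: "openin \<tau> = Q"
    by (simp add: \<tau>_def)
  have "Q X"
    using class_of_subset by (simp add: Q_def)
  moreover have "U \<subseteq> X" if "Q U" for U
    using that openin_imp_subset unfolding Q_def by blast
  ultimately have top: "topspace \<tau> = X"
    unfolding topspace_def \<tau> by blast
  have closed: "closed C" and sat: "\<And>x. x \<in> C \<Longrightarrow> class_of x \<subseteq> C" if C: "closedin \<tau> C" for C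
  proof -
    have "C \<subseteq> X" "Q (X - C)"
      using C by (auto simp: closedin_def top \<tau>)
    then have "closedin (top_of_set X) C"
      by (auto simp: closedin_def Q_def)
    then show "closed C"
      using compact_X by (meson closedin_closed_trans compact_imp_closed)
    show "class_of x \<subseteq> C" if "x \<in> C" for x
    proof
      fix y assume y: "y \<in> class_of x"
      then have "x \<in> class_of y" "y \<in> X"
        using in_class_of_sym class_of_subset by blast+
      then show "y \<in> C"
        using \<open>Q (X - C)\<close> that by (auto simp: Q_def)
    qed
  qed
  have normal: "normal_space \<tau>"
    unfolding normal_space_def
  proof (intro allI impI)
    fix S T assume ST: "closedin \<tau> S \<and> closedin \<tau> T \<and> disjnt S T"
    then obtain U V where UV: "open U" "open V" "S \<subseteq> U" "T \<subseteq> V" "U \<inter> V = {}"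
      using closed_disjoint_separation[of S T] closed by (auto simp: disjnt_def)
    \<comment> \<open>The union of all classes contained in an open set is open and saturated; it
      still contains every saturated subset of that open set.\<close>
    define U' V' where "U' = {x \<in> X. class_of x \<subseteq> X \<inter> U}" and "V' = {x \<in> X. class_of x \<subseteq> X \<inter> V}"
    have "Q {x \<in> X. class_of x \<subseteq> X \<inter> W}" if "open W" for W
      unfolding Q_def using openin_class_of_subset[of "X \<inter> W"] that class_of_eq
      by (auto simp: openin_open_Int dest: class_of_subset[THEN subsetD])
    then have "openin \<tau> U'" "openin \<tau> V'"
      using UV by (auto simp: U'_def V'_def \<tau>)
    moreover have "C \<subseteq> {x \<in> X. class_of x \<subseteq> X \<inter> W}" if "closedin \<tau> C" "C \<subseteq> W" for C W
    proof
      fix x assume "x \<in> C"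
      then show "x \<in> {x \<in> X. class_of x \<subseteq> X \<inter> W}"
        using sat[OF that(1) \<open>x \<in> C\<close>] that(2) closedin_subset[OF that(1)] top class_of_subset by auto
    qed
    then have "S \<subseteq> U'" "T \<subseteq> V'"
      using ST UV(3,4) by (simp_all add: U'_def V'_def)
    moreover have "disjnt U' V'"
      using in_class_of_self UV(5) unfolding U'_def V'_def disjnt_def by blast
    ultimately show "\<exists>U V. openin \<tau> U \<and> openin \<tau> V \<and> S \<subseteq> U \<and> T \<subseteq> V \<and> disjnt U V"
      by blast
  qed
  have closedin_class: "closedin \<tau> (class_of x)" if "x \<in> X" for x
  proof -
    have "openin (top_of_set X) (X - class_of x)"
      using closed_class_of[OF that] by (simp add: Diff_eq open_Compl openin_open_Int)
    moreover have "class_of y \<subseteq> X - class_of x" if "y \<in> X - class_of x" for y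
      using that class_of_subset in_class_of_sym in_class_of_trans by blast
    ultimately show ?thesis
      using class_of_subset by (simp add: closedin_def top \<tau> Q_def)
  qed
  obtain a where a: "a \<in> X"
    using nonempty_X by blast
  obtain b where b: "b \<in> X" "b \<notin> class_of a"
    using class_of_proper[OF a] by blast
  then have "disjnt (class_of a) (class_of b)"
    unfolding disjnt_def using in_class_of_sym in_class_of_trans by blast
  then obtain g :: "'a \<Rightarrow> real" where g: "continuous_map \<tau> euclideanreal g" "g ` class_of a \<subseteq> {0}" "g ` class_of b \<subseteq> {1}"
    by (rule Urysohn_lemma_alt[OF normal closedin_class[OF a] closedin_class[OF b(1)]])
  have Q: "Q {x \<in> X. g x \<in> U}" if "open U" for U
    using g(1) that by (simp add: continuous_map_def top \<tau>)
  show thesis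
  proof
    have "continuous_map (top_of_set X) euclideanreal g"
      using Q by (simp add: continuous_map_def Q_def)
    then show "continuous_on X g"
      by simp
    show "g y = g x" if "x \<in> X" "y \<in> class_of x" for x y
    proof (rule ccontr)
      assume "g y \<noteq> g x"
      \<comment> \<open>The set where \<open>g\<close> differs from \<open>g x\<close> is saturated;
        containing \<open>y\<close>, it would also contain \<open>x\<close>.\<close>
      then have "class_of y \<subseteq> {z \<in> X. g z \<in> - {g x}}"
        using Q[of "- {g x}"] that class_of_subset unfolding Q_def by blast
      then show False
        using in_class_of_sym[OF that(2)] by blast
    qed
    show "a \<in> X" "b \<in> X"
      by fact+
    show "g a \<noteq> g b"
      using g(2,3) in_class_of_self[OF a] in_class_of_self[OF b(1)] by (simp add: image_subset_iff)
  qed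
qed

end

subsection \<open>Growth of continua modulo asymptotic ones\<close>

text \<open>The assumption on \<open>f\<close> in the third place says that \<open>f\<close> descends along \<open>\<Phi>\<close> to a uniformly continuous
  map. In particular, once an iterate of a continuum is collapsed by \<open>\<Phi>\<close>, so are all later ones.\<close>

locale class_collapse = suslinean_mixing X f
  for X :: "'a::metric_space set" and f :: "'a \<Rightarrow> 'a" +
  fixes \<Phi> :: "'a \<Rightarrow> 'b::metric_space" and a b :: 'a and \<delta> :: real
  assumes continuous_\<Phi>: "continuous_on X \<Phi>"
    and \<Phi>_asymptotic: "\<And>K x y. subcontinuum K X \<Longrightarrow> asymptotic K \<Longrightarrow> x \<in> K \<Longrightarrow> y \<in> K \<Longrightarrow> \<Phi> x = \<Phi> y"
    and \<Phi>_step: "\<And>\<theta>. \<theta> > 0 \<Longrightarrow> \<exists>\<kappa>>0. \<forall>x\<in>X. \<forall>y\<in>X. dist (\<Phi> x) (\<Phi> y) < \<kappa> \<longrightarrow> dist (\<Phi> (f x)) (\<Phi> (f y)) < \<theta>"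
    and a: "a \<in> X" and b: "b \<in> X" and \<delta>: "\<delta> > 0" "4 * \<delta> < dist (\<Phi> a) (\<Phi> b)"
begin

definition large :: "real \<Rightarrow> 'a set \<Rightarrow> bool"
  where "large e K \<longleftrightarrow> (\<exists>x\<in>K. \<exists>y\<in>K. e \<le> dist (\<Phi> x) (\<Phi> y))"

lemma continuous_\<Phi>_iter: "continuous_on X (\<lambda>x. \<Phi> ((f ^^ n) x))"
  by (rule continuous_on_compose2[OF continuous_\<Phi> continuous_iter]) (auto simp: iter_in)

text \<open>One \<open>\<kappa>\<close> serves all exponents up to \<open>i\<close>. In
  \<open>large_iterates\<close> the number of steps left after the small iterate varies with
  \<open>k\<close> and is only bounded by \<open>i\<close>.\<close>

lemma \<Phi>_steps:
  "\<theta> > 0 \<Longrightarrow> \<exists>\<kappa>>0. \<forall>s\<le>i. \<forall>x\<in>X. \<forall>y\<in>X. dist (\<Phi> x) (\<Phi> y) < \<kappa> \<longrightarrow> dist (\<Phi> ((f ^^ s) x)) (\<Phi> ((f ^^ s) y)) < \<theta>"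
proof (induction i arbitrary: \<theta>)
  case 0
  then show ?case
    by (intro exI[of _ \<theta>]) simp
next
  case (Suc i)
  obtain \<kappa>1 where \<kappa>1: "\<kappa>1 > 0" "\<forall>x\<in>X. \<forall>y\<in>X. dist (\<Phi> x) (\<Phi> y) < \<kappa>1 \<longrightarrow> dist (\<Phi> (f x)) (\<Phi> (f y)) < \<theta>"
    using \<Phi>_step[OF Suc.prems] by blast
  define \<theta>' where "\<theta>' = min \<theta> \<kappa>1"
  have "\<theta>' > 0"
    using \<kappa>1 Suc.prems by (simp add: \<theta>'_def)
  then obtain \<kappa> where \<kappa>: "\<kappa> > 0"
    "\<forall>s\<le>i. \<forall>x\<in>X. \<forall>y\<in>X. dist (\<Phi> x) (\<Phi> y) < \<kappa> \<longrightarrow> dist (\<Phi> ((f ^^ s) x)) (\<Phi> ((f ^^ s) y)) < \<theta>'"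
    using Suc.IH by blast
  have "dist (\<Phi> ((f ^^ s) x)) (\<Phi> ((f ^^ s) y)) < \<theta>"
    if "s \<le> Suc i" and xy: "x \<in> X" "y \<in> X" "dist (\<Phi> x) (\<Phi> y) < \<kappa>" for s x y
  proof (cases "s = Suc i")
    case True
    have "dist (\<Phi> ((f ^^ i) x)) (\<Phi> ((f ^^ i) y)) < \<kappa>1"
      using \<kappa>(2) xy by (auto simp: \<theta>'_def)
    then show ?thesis
      using \<kappa>1(2) iter_in[OF xy(1), of i] iter_in[OF xy(2), of i] True by simp
  next
    case False
    then show ?thesis
      using \<kappa>(2) that by (auto simp: \<theta>'_def)
  qed
  then show ?case
    using \<kappa>(1) by (intro exI[of _ \<kappa>]) blast
qed

text \<open>A topological limit of such \<open>K k\<close> would be a continuum whose iterates have \<open>\<Phi>\<close>-images of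
  diameter at most \<open>2\<delta>\<close>. Hence it would be asymptotic, although \<open>\<Phi>\<close> is not constant on it.\<close>

lemma no_stable_limit_convergent:
  assumes K: "\<And>k::nat. subcontinuum (K k) X"
    and uv: "\<And>k. u k \<in> K k" "\<And>k. v k \<in> K k" "\<And>k. \<eta> \<le> dist (\<Phi> (u k)) (\<Phi> (v k))" "\<eta> > 0"
    and lim: "u \<longlonglongrightarrow> u'" "v \<longlonglongrightarrow> v'"
    and small: "\<And>i. i \<ge> 1 \<Longrightarrow> \<forall>\<^sub>F k in sequentially. \<forall>x\<in>K k. \<forall>y\<in>K k. dist (\<Phi> ((f ^^ i) x)) (\<Phi> ((f ^^ i) y)) \<le> \<delta>"
  shows False
proof -
  define L where "L = (\<Inter>m. closure (\<Union>k\<in>{m..}. K k))"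
  have KX: "K k \<subseteq> X" for k
    using K subcontinuum_subset by blast
  have conn: "connected (K k)" for k
    using K by (simp add: subcontinuum_def continuum_def)
  have uL: "u' \<in> L" and vL: "v' \<in> L"
    unfolding L_def using limit_in_limsup lim uv by blast+
  have LX: "L \<subseteq> X"
  proof -
    have "L \<subseteq> closure (\<Union>k\<in>{0..}. K k)"
      unfolding L_def by blast
    also have "\<dots> \<subseteq> X"
      using KX compact_X by (intro closure_minimal) (auto simp: compact_imp_closed)
    finally show ?thesis .
  qed
  have "closed L"
    unfolding L_def by (intro closed_INT) auto
  then have "compact L"
    using LX compact_Int_closed[OF compact_X, of L] by (simp add: inf.absorb2)
  moreover have "connected L"
    unfolding L_def using connected_limsup[OF compact_X conn KX uv(1) lim(1)] .
  ultimately have L: "subcontinuum L X"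
    using uL LX by (auto simp: subcontinuum_def continuum_def)
  have tendsto_\<Phi>: "(\<lambda>k. \<Phi> ((f ^^ i) (w k))) \<longlonglongrightarrow> \<Phi> ((f ^^ i) z)" if "w \<longlonglongrightarrow> z" "z \<in> L" "\<And>k. w k \<in> X" for w z i
    using continuous_on_tendsto_compose[OF continuous_\<Phi>_iter that(1)] that LX by auto
  have near: "dist (\<Phi> ((f ^^ i) z)) (\<Phi> ((f ^^ i) u')) \<le> \<delta>" if z: "z \<in> L" and i: "i \<ge> 1" for z i
  proof -
    obtain m0 where m0: "\<And>k x y. k \<ge> m0 \<Longrightarrow> x \<in> K k \<Longrightarrow> y \<in> K k \<Longrightarrow> dist (\<Phi> ((f ^^ i) x)) (\<Phi> ((f ^^ i) y)) \<le> \<delta>"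
      using small[OF i] unfolding eventually_sequentially by blast
    \<comment> \<open>A point of the upper limit is approximated from sets with indices tending to
      infinity. There it can be compared with the points of \<open>u\<close>, which converge to
      \<open>u'\<close>.\<close>
    have "\<exists>k w. k \<ge> max m0 n \<and> w \<in> K k \<and> dist w z < inverse (real (Suc n))" for n
    proof -
      have "z \<in> closure (\<Union>k\<in>{max m0 n..}. K k)"
        using z unfolding L_def by blast
      then have "\<exists>w\<in>(\<Union>k\<in>{max m0 n..}. K k). dist w z < inverse (real (Suc n))"
        unfolding closure_approachable by simp
      then show ?thesis
        by auto
    qed
    then obtain \<kappa> w where w: "\<And>n. \<kappa> n \<ge> max m0 n" "\<And>n. w n \<in> K (\<kappa> n)" "\<And>n. dist (w n) z < inverse (real (Suc n))"
      by metis
    have "norm (dist (w n) z) \<le> inverse (real (Suc n))" for n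
      using w(3)[of n] by simp
    then have "(\<lambda>n. dist (w n) z) \<longlonglongrightarrow> 0"
      by (intro Lim_null_comparison[OF _ LIMSEQ_inverse_real_of_nat] always_eventually) blast
    then have "w \<longlonglongrightarrow> z"
      by (rule tendsto_dist_iff[THEN iffD2])
    moreover have "filterlim \<kappa> at_top sequentially"
      by (rule filterlim_at_top_mono[OF filterlim_ident]) (use w(1) in \<open>simp add: always_eventually\<close>)
    then have "(\<lambda>n. u (\<kappa> n)) \<longlonglongrightarrow> u'"
      by (rule filterlim_compose[OF lim(1)])
    moreover have "w n \<in> X" "u (\<kappa> n) \<in> X" for n
      using w(2) uv(1) KX by blast+
    ultimately have "(\<lambda>n. dist (\<Phi> ((f ^^ i) (w n))) (\<Phi> ((f ^^ i) (u (\<kappa> n))))) \<longlonglongrightarrow> dist (\<Phi> ((f ^^ i) z)) (\<Phi> ((f ^^ i) u'))"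
      using z uL by (intro tendsto_dist tendsto_\<Phi>) auto
    moreover have "dist (\<Phi> ((f ^^ i) (w n))) (\<Phi> ((f ^^ i) (u (\<kappa> n)))) \<le> \<delta>" for n
      using m0[OF _ w(2) uv(1)] w(1)[of n] by simp
    ultimately show ?thesis
      by (intro LIMSEQ_le_const2) auto
  qed
  have "asymptotic L"
  proof (rule stable_imp_asymptotic[OF L continuous_\<Phi> a b])
    \<comment> \<open>Only distances to the image of \<open>u'\<close> are controlled, so two points
      of \<open>L\<close> come within \<open>2 * \<delta>\<close>. This is the source of the factor
      4 in the choice of \<open>\<delta>\<close>.\<close>
    show "2 * (2 * \<delta>) < dist (\<Phi> a) (\<Phi> b)"
      using \<delta> by simp
    show "dist (\<Phi> ((f ^^ n) x)) (\<Phi> ((f ^^ n) y)) \<le> 2 * \<delta>" if "n \<ge> 1" "x \<in> L" "y \<in> L" for n x y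
      using near[OF that(2,1)] near[OF that(3,1)] dist_triangle2[of "\<Phi> ((f ^^ n) x)" "\<Phi> ((f ^^ n) y)" "\<Phi> ((f ^^ n) u')"]
      by simp
  qed
  then have "\<Phi> u' = \<Phi> v'"
    using \<Phi>_asymptotic[OF L _ uL vL] by simp
  moreover have "(\<lambda>k. dist (\<Phi> (u k)) (\<Phi> (v k))) \<longlonglongrightarrow> dist (\<Phi> u') (\<Phi> v')"
    using tendsto_\<Phi>[OF lim(1) uL, of 0] tendsto_\<Phi>[OF lim(2) vL, of 0] uv(1,2) KX
    by (intro tendsto_dist) auto
  then have "\<eta> \<le> dist (\<Phi> u') (\<Phi> v')"
    using uv(3) by (intro LIMSEQ_le_const) auto
  ultimately show False
    using uv(4) by simp
qed

text \<open>Compactness makes the two distant points converge along a common subsequence, and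
  eventual smallness survives the passage to it.\<close>

lemma no_stable_limit:
  assumes K: "\<And>k::nat. subcontinuum (K k) X" "\<And>k. large \<eta> (K k)" "\<eta> > 0"
    and small: "\<And>i. i \<ge> 1 \<Longrightarrow> \<forall>\<^sub>F k in sequentially. \<forall>x\<in>K k. \<forall>y\<in>K k. dist (\<Phi> ((f ^^ i) x)) (\<Phi> ((f ^^ i) y)) \<le> \<delta>"
  shows False
proof -
  have "\<exists>u v. u \<in> K k \<and> v \<in> K k \<and> \<eta> \<le> dist (\<Phi> u) (\<Phi> v)" for k
    using K(2)[of k] unfolding large_def by blast
  then obtain u v where uv: "\<And>k. u k \<in> K k" "\<And>k. v k \<in> K k" "\<And>k. \<eta> \<le> dist (\<Phi> (u k)) (\<Phi> (v k))"
    by metis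
  have uvX: "u k \<in> X" "v k \<in> X" for k
    using uv(1,2)[of k] subcontinuum_subset[OF K(1)[of k]] by blast+
  obtain u' r where r: "strict_mono (r :: nat \<Rightarrow> nat)" "(\<lambda>k. u (r k)) \<longlonglongrightarrow> u'"
    by (rule compact_limit[of u]) (use uvX in auto)
  obtain v' s where s: "strict_mono (s :: nat \<Rightarrow> nat)" "(\<lambda>k. v (r (s k))) \<longlonglongrightarrow> v'"
    by (rule compact_limit[of "\<lambda>k. v (r k)"]) (use uvX in auto)
  have rs: "strict_mono (\<lambda>k. r (s k))"
    using strict_mono_o[OF r(1) s(1)] by (simp add: comp_def)
  have "(\<lambda>k. u (r (s k))) \<longlonglongrightarrow> u'"
    using LIMSEQ_subseq_LIMSEQ[OF r(2) s(1)] by (simp add: comp_def)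
  from no_stable_limit_convergent[of "\<lambda>k. K (r (s k))", OF K(1) uv K(3) this s(2)] show False
    using eventually_subseq[OF rs small] by blast
qed

section \<open>Uniform lower bounds and uniform growth for large continua\<close>

lemma not_large_iff: "\<not> large e K \<longleftrightarrow> (\<forall>x\<in>K. \<forall>y\<in>K. dist (\<Phi> x) (\<Phi> y) < e)"
  by (auto simp: large_def not_le)

lemma large_mono: "large e K \<Longrightarrow> e' \<le> e \<Longrightarrow> large e' K"
  unfolding large_def by (meson order_trans)

text \<open>If an iterate became tiny at time \<open>n k\<close>, restart at the last earlier time
  when it was \<open>\<delta>\<close>-large. From there it is small up to \<open>n k\<close> by
  maximality, and for a long time afterwards by uniform continuity modulo \<open>\<Phi>\<close>.
  Such continua would have a stable limit.\<close>

lemma large_iterates: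
  obtains \<eta> where "\<eta> > 0" "\<eta> \<le> \<delta>" "\<And>K n. subcontinuum K X \<Longrightarrow> large \<delta> K \<Longrightarrow> large \<eta> ((f ^^ n) ` K)"
proof (rule ccontr)
  assume contra: "\<not> thesis"
  have "\<exists>K n. subcontinuum K X \<and> large \<delta> K \<and> \<not> large (min \<delta> (inverse (real (Suc k)))) ((f ^^ n) ` K)" for k
  proof (rule ccontr)
    assume "\<not> ?thesis"
    then show False
      using contra that[of "min \<delta> (inverse (real (Suc k)))"] \<delta> by auto
  qed
  then obtain K n where K: "\<And>k. subcontinuum (K k) X" "\<And>k. large \<delta> (K k)"
    "\<And>k. \<not> large (min \<delta> (inverse (real (Suc k)))) ((f ^^ n k) ` K k)"
    by metis
  \<comment> \<open>Exponent 0 qualifies because \<open>K k\<close> is itself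
    \<open>\<delta>\<close>-large, so the maximum exists.\<close>
  define m where "m k = (GREATEST i. i \<le> n k \<and> large \<delta> ((f ^^ i) ` K k))" for k
  have m: "m k \<le> n k \<and> large \<delta> ((f ^^ m k) ` K k)" for k
    unfolding m_def by (rule GreatestI_nat[of _ 0 "n k"]) (use K(2) in auto)
  have m_max: "i \<le> m k" if "i \<le> n k" "large \<delta> ((f ^^ i) ` K k)" for i k
    unfolding m_def by (rule Greatest_le_nat[of _ i "n k"]) (use that in auto)
  define L where "L k = (f ^^ m k) ` K k" for k
  define N where "N k = n k - m k" for k
  have image: "(f ^^ i) ` L k = (f ^^ (i + m k)) ` K k" for i k
    by (simp add: L_def funpow_add image_comp)
  have L: "subcontinuum (L k) X" for k
    unfolding L_def by (rule subcontinuum_iter[OF K(1)])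
  show False
  proof (rule no_stable_limit[OF L])
    show "large \<delta> (L k)" for k
      using m by (simp add: L_def)
    show "\<delta> > 0"
      by (rule \<delta>)
    fix i :: nat assume i: "i \<ge> 1"
    obtain \<kappa> where \<kappa>: "\<kappa> > 0"
      "\<And>s x y. s \<le> i \<Longrightarrow> x \<in> X \<Longrightarrow> y \<in> X \<Longrightarrow> dist (\<Phi> x) (\<Phi> y) < \<kappa> \<Longrightarrow> dist (\<Phi> ((f ^^ s) x)) (\<Phi> ((f ^^ s) y)) < \<delta>"
      using \<Phi>_steps[OF \<delta>(1), of i] by metis
    have "\<forall>\<^sub>F k in sequentially. inverse (real (Suc k)) < \<kappa>"
      using LIMSEQ_inverse_real_of_nat \<kappa>(1) by (rule order_tendstoD)
    then show "\<forall>\<^sub>F k in sequentially. \<forall>x\<in>L k. \<forall>y\<in>L k. dist (\<Phi> ((f ^^ i) x)) (\<Phi> ((f ^^ i) y)) \<le> \<delta>"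
    proof (rule eventually_mono, intro ballI)
      fix k x y assume k: "inverse (real (Suc k)) < \<kappa>" and xy: "x \<in> L k" "y \<in> L k"
      show "dist (\<Phi> ((f ^^ i) x)) (\<Phi> ((f ^^ i) y)) \<le> \<delta>"
      proof (cases "i \<le> N k")
        case True
        then have "i + m k \<le> n k" "\<not> i + m k \<le> m k"
          using i m[of k] by (auto simp: N_def)
        then have "\<not> large \<delta> ((f ^^ i) ` L k)"
          using m_max[of "i + m k" k] unfolding image by blast
        then show ?thesis
          using xy unfolding not_large_iff by (simp add: less_imp_le)
      next
        case False
        have "N k + m k = n k"
          using m[of k] by (simp add: N_def)
        then have "\<not> large (min \<delta> (inverse (real (Suc k)))) ((f ^^ N k) ` L k)"
          using K(3)[of k] by (simp only: image not_False_eq_True)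
        then have "dist (\<Phi> ((f ^^ N k) x)) (\<Phi> ((f ^^ N k) y)) < min \<delta> (inverse (real (Suc k)))"
          using xy unfolding not_large_iff by blast
        then have "dist (\<Phi> ((f ^^ N k) x)) (\<Phi> ((f ^^ N k) y)) < \<kappa>"
          using k by linarith
        moreover have "x \<in> X" "y \<in> X"
          using xy subcontinuum_subset[OF L] by blast+
        ultimately have "dist (\<Phi> ((f ^^ (i - N k)) ((f ^^ N k) x))) (\<Phi> ((f ^^ (i - N k)) ((f ^^ N k) y))) < \<delta>"
          by (intro \<kappa>(2)) (auto simp: iter_in)
        moreover have "(f ^^ (i - N k)) ((f ^^ N k) z) = (f ^^ i) z" for z
          using False by (metis comp_apply funpow_add le_add_diff_inverse2 nat_le_linear)
        ultimately show ?thesis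
          by simp
      qed
    qed
  qed
qed

text \<open>Without a common bound there would be \<open>\<eta>\<close>-large continua that stay
  \<open>\<delta>\<close>-small for longer and longer times, which \<open>no_stable_limit\<close>
  forbids.\<close>

lemma uniform_growth:
  assumes "\<eta> > 0"
  obtains G where "G \<ge> 1" "\<And>K. subcontinuum K X \<Longrightarrow> large \<eta> K \<Longrightarrow> \<exists>j\<le>G. large \<delta> ((f ^^ j) ` K)"
proof (rule ccontr)
  assume contra: "\<not> thesis"
  have "\<exists>K. subcontinuum K X \<and> large \<eta> K \<and> (\<forall>j\<le>Suc k. \<not> large \<delta> ((f ^^ j) ` K))" for k
  proof (rule ccontr)
    assume "\<not> ?thesis"
    then show False
      using contra that[of "Suc k"] by auto
  qed
  then obtain K where K: "\<And>k. subcontinuum (K k) X" "\<And>k. large \<eta> (K k)"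
    "\<And>k j. j \<le> Suc k \<Longrightarrow> \<not> large \<delta> ((f ^^ j) ` K k)"
    by metis
  show False
  proof (rule no_stable_limit[OF K(1,2) assms])
    fix i :: nat
    have "\<forall>x\<in>K k. \<forall>y\<in>K k. dist (\<Phi> ((f ^^ i) x)) (\<Phi> ((f ^^ i) y)) \<le> \<delta>" if "i \<le> k" for k
      using K(3)[of i k] that unfolding not_large_iff by (auto simp: less_imp_le)
    then show "\<forall>\<^sub>F k in sequentially. \<forall>x\<in>K k. \<forall>y\<in>K k. dist (\<Phi> ((f ^^ i) x)) (\<Phi> ((f ^^ i) y)) \<le> \<delta>"
      by (rule eventually_mono[OF eventually_ge_at_top])
  qed
qed

text \<open>Of two points at distance \<open>\<eta>\<close> under \<open>\<Phi>\<close>, one is at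
  least \<open>\<eta> / 2\<close> away from \<open>q\<close>. Its component outside the ball of
  radius \<open>\<eta> / 6\<close> reaches the boundary of that ball by boundary bumping, unless
  \<open>K\<close> misses the ball altogether. It thus spans at least
  \<open>\<eta> / 2 - \<eta> / 6 = \<eta> / 3\<close>.\<close>

lemma large_subcontinuum_avoiding:
  assumes K: "subcontinuum K X" "large \<eta> K" and "\<eta> > 0"
  obtains C where "C \<subseteq> K" "subcontinuum C X" "large (\<eta> / 3) C" "\<And>z. z \<in> C \<Longrightarrow> \<eta> / 6 \<le> dist (\<Phi> z) q"
proof -
  define S where "S = {z \<in> K. \<eta> / 6 \<le> dist (\<Phi> z) q}"
  have KX: "K \<subseteq> X" "compact K" "connected K"
    using K(1) by (auto simp: subcontinuum_def continuum_def)
  have cont: "continuous_on K (\<lambda>z. dist (\<Phi> z) q)"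
    using continuous_on_subset[OF continuous_\<Phi> KX(1)] by (intro continuous_intros)
  have closed: "closed S"
    unfolding S_def using cont compact_imp_closed[OF KX(2)] by (intro continuous_on_closed_Collect_le) auto
  show thesis
  proof (cases "S = K")
    case True
    then have "\<eta> / 6 \<le> dist (\<Phi> z) q" if "z \<in> K" for z
      using that unfolding S_def by blast
    moreover have "large (\<eta> / 3) K"
      using K(2) by (rule large_mono) (use \<open>\<eta> > 0\<close> in simp)
    ultimately show thesis
      using that[of K] K(1) by blast
  next
    case False
    obtain u v where "u \<in> K" "v \<in> K" "\<eta> \<le> dist (\<Phi> u) (\<Phi> v)"
      using K(2) unfolding large_def by blast
    then have "\<eta> / 2 \<le> dist (\<Phi> u) q \<or> \<eta> / 2 \<le> dist (\<Phi> v) q"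
      using dist_triangle2[of "\<Phi> u" "\<Phi> v" q] by linarith
    then obtain x where x: "x \<in> K" "\<eta> / 2 \<le> dist (\<Phi> x) q"
      using \<open>u \<in> K\<close> \<open>v \<in> K\<close> by blast
    then have xS: "x \<in> S"
      using \<open>\<eta> > 0\<close> by (simp add: S_def)
    have SK: "S \<subseteq> K"
      by (auto simp: S_def)
    define C where "C = connected_component_of_set (top_of_set S) x"
    have sub: "subtopology (top_of_set K) S = top_of_set S"
      using SK by (simp add: subtopology_subtopology inf.absorb2)
    have C: "x \<in> C" "connected C" "closedin (top_of_set S) C"
      unfolding C_def using xS connectedin_connected_component_of[of "top_of_set S" x]
      by (auto simp: connected_component_of_refl closedin_connected_component_of connectedin_subtopology)
    then have CS: "C \<subseteq> S"
      using closedin_imp_subset by blast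
    have "compact S"
      using compact_Int_closed[OF KX(2) closed] SK by (simp add: inf.absorb2)
    then have "compact C"
      using C(3) closedin_compact by blast
    then have C_sub: "subcontinuum C X"
      using C CS SK KX by (auto simp: subcontinuum_def continuum_def)
    have "C \<inter> (top_of_set K) frontier_of S \<noteq> {}"
    proof (rule boundary_bumping_theorem_closed)
      show "C \<in> connected_components_of (subtopology (top_of_set K) S)"
        unfolding sub C_def using xS by (simp add: connected_component_in_connected_components_of)
      show "closedin (top_of_set K) S"
        using closed SK by (rule closed_subset[rotated])
      show "S \<noteq> topspace (top_of_set K)"
        using False by simp
    qed (use KX in \<open>auto simp: connected_space_subtopology compact_space_subtopology Hausdorff_space_subtopology\<close>)
    then obtain z where z: "z \<in> C" "z \<in> (top_of_set K) frontier_of S"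
      by blast
    have "(top_of_set K) frontier_of S \<subseteq> {z \<in> K. dist (\<Phi> z) q \<le> \<eta> / 6}"
    proof -
      have "closed {z \<in> K. dist (\<Phi> z) q \<le> \<eta> / 6}"
        using cont compact_imp_closed[OF KX(2)] by (intro continuous_on_closed_Collect_le) auto
      then have "closedin (top_of_set K) {z \<in> K. dist (\<Phi> z) q \<le> \<eta> / 6}"
        by (intro closed_subset) auto
      moreover have "K - S \<subseteq> {z \<in> K. dist (\<Phi> z) q \<le> \<eta> / 6}"
        by (auto simp: S_def)
      ultimately have "(top_of_set K) closure_of (K - S) \<subseteq> {z \<in> K. dist (\<Phi> z) q \<le> \<eta> / 6}"
        by (intro closure_of_minimal)
      then show ?thesis
        by (simp add: frontier_of_closures le_infI2)
    qed
    then have "dist (\<Phi> z) q \<le> \<eta> / 6"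
      using z(2) by blast
    then have "\<eta> / 3 \<le> dist (\<Phi> x) (\<Phi> z)"
      using x(2) dist_triangle[of "\<Phi> x" q "\<Phi> z"] by simp
    then have "large (\<eta> / 3) C"
      using C(1) z(1) unfolding large_def by blast
    moreover have "\<eta> / 6 \<le> dist (\<Phi> z) q" if "z \<in> C" for z
      using that CS by (auto simp: S_def)
    ultimately show thesis
      using that[of C] C_sub CS SK by blast
  qed
qed

text \<open>Mane's argument: since \<open>f\<^sup>G\<close> expands large continua by a factor \<open>3\<close>, one can keep choosing large
  subcontinua of the images that avoid a fixed ball.\<close>

lemma avoiding_point:
  assumes grow: "\<And>K. subcontinuum K X \<Longrightarrow> large (\<eta> / 3) K \<Longrightarrow> large \<eta> ((f ^^ G) ` K)" and "\<eta> > 0"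
  shows "subcontinuum K X \<Longrightarrow> large (\<eta> / 3) K \<Longrightarrow> \<exists>x\<in>K. \<forall>i\<in>{1..m}. \<eta> / 6 \<le> dist (\<Phi> ((f ^^ (G * i)) x)) q"
proof (induction m arbitrary: K)
  case 0
  then show ?case
    using subcontinuum_nonempty by auto
next
  case (Suc m)
  obtain C where C: "C \<subseteq> (f ^^ G) ` K" "subcontinuum C X" "large (\<eta> / 3) C" "\<And>z. z \<in> C \<Longrightarrow> \<eta> / 6 \<le> dist (\<Phi> z) q"
    by (rule large_subcontinuum_avoiding[OF subcontinuum_iter[OF Suc.prems(1)] grow[OF Suc.prems] \<open>\<eta> > 0\<close>, of q]) blast
  obtain y where y: "y \<in> C" "\<forall>i\<in>{1..m}. \<eta> / 6 \<le> dist (\<Phi> ((f ^^ (G * i)) y)) q"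
    using Suc.IH[OF C(2,3)] by blast
  obtain x where x: "x \<in> K" "y = (f ^^ G) x"
    using y(1) C(1) by blast
  have "\<eta> / 6 \<le> dist (\<Phi> ((f ^^ (G * i)) x)) q" if i: "i \<in> {1..Suc m}" for i
  proof (cases "i = 1")
    case True
    then show ?thesis
      using C(4)[OF y(1)] x(2) by simp
  next
    case False
    then obtain j where "i = Suc j" "j \<in> {1..m}"
      using i by (cases i) auto
    moreover have "(f ^^ (G * Suc j)) x = (f ^^ (G * j)) y"
      by (simp add: x(2) funpow_add add.commute[of G])
    ultimately show ?thesis
      using y(2) by simp
  qed
  then show ?case
    using x(1) by blast
qed

lemma contradiction: False
proof -
  obtain \<eta> where \<eta>: "\<eta> > 0" "\<eta> \<le> \<delta>" "\<And>K n. subcontinuum K X \<Longrightarrow> large \<delta> K \<Longrightarrow> large \<eta> ((f ^^ n) ` K)"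
    by (rule large_iterates) blast
  obtain G where G: "G \<ge> 1" "\<And>K. subcontinuum K X \<Longrightarrow> large (\<eta> / 3) K \<Longrightarrow> \<exists>j\<le>G. large \<delta> ((f ^^ j) ` K)"
    by (rule uniform_growth[of "\<eta> / 3"]) (use \<eta>(1) in auto)
  \<comment> \<open>The time \<open>j\<close> of becoming \<open>\<delta>\<close>-large depends on
    \<open>K\<close>, but all later iterates remain \<open>\<eta>\<close>-large. Hence the single
    exponent \<open>G\<close> works for every \<open>K\<close>.\<close>
  have grow: "large \<eta> ((f ^^ G) ` K)" if K: "subcontinuum K X" "large (\<eta> / 3) K" for K
  proof -
    obtain j where j: "j \<le> G" "large \<delta> ((f ^^ j) ` K)"
      using G(2)[OF K] by blast
    have "large \<eta> ((f ^^ (G - j)) ` (f ^^ j) ` K)"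
      by (rule \<eta>(3)[OF subcontinuum_iter[OF K(1)] j(2)])
    moreover have "(f ^^ (G - j)) ` (f ^^ j) ` K = (f ^^ G) ` K"
      using j(1) by (metis funpow_add image_comp le_add_diff_inverse2)
    ultimately show ?thesis
      by simp
  qed
  define Y where "Y m = {x \<in> X. \<forall>i\<in>{1..m}. \<eta> / 6 \<le> dist (\<Phi> ((f ^^ (G * i)) x)) (\<Phi> a)}" for m
  have X_sub: "subcontinuum X X"
    using continuum_X by (simp add: subcontinuum_def)
  have X_large: "large (\<eta> / 3) X"
    unfolding large_def using a b \<delta> \<eta>(1,2) by (intro bexI[of _ a] bexI[of _ b]) auto
  have Y_compact: "compact (Y m)" for m
  proof -
    have "closed {x \<in> X. \<eta> / 6 \<le> dist (\<Phi> ((f ^^ (G * i)) x)) (\<Phi> a)}" for i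
      using compact_imp_closed[OF compact_X]
      by (intro continuous_on_closed_Collect_le continuous_on_dist continuous_\<Phi>_iter continuous_on_const) auto
    then have "closed (\<Inter>i\<in>{1..m}. {x \<in> X. \<eta> / 6 \<le> dist (\<Phi> ((f ^^ (G * i)) x)) (\<Phi> a)})"
      by blast
    then have "compact (X \<inter> (\<Inter>i\<in>{1..m}. {x \<in> X. \<eta> / 6 \<le> dist (\<Phi> ((f ^^ (G * i)) x)) (\<Phi> a)}))"
      by (rule compact_Int_closed[OF compact_X])
    also have "X \<inter> (\<Inter>i\<in>{1..m}. {x \<in> X. \<eta> / 6 \<le> dist (\<Phi> ((f ^^ (G * i)) x)) (\<Phi> a)}) = Y m"
      by (auto simp: Y_def)
    finally show ?thesis .
  qed
  have Y_nonempty: "Y m \<noteq> {}" for m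
    using avoiding_point[OF grow \<eta>(1) X_sub X_large, of m "\<Phi> a"] unfolding Y_def by blast
  define Z where "Z = (\<Inter>m. Y m)"
  have Z_iff: "x \<in> Z \<longleftrightarrow> x \<in> X \<and> (\<forall>i\<ge>1. \<eta> / 6 \<le> dist (\<Phi> ((f ^^ (G * i)) x)) (\<Phi> a))" for x
  proof -
    have "(\<forall>m. \<forall>i\<in>{1..m}. P i) \<longleftrightarrow> (\<forall>i\<ge>1. P i)" for P :: "nat \<Rightarrow> bool"
      by (meson atLeastAtMost_iff order_refl)
    then show ?thesis
      unfolding Z_def Y_def by simp
  qed
  have "Z \<noteq> {}"
    unfolding Z_def by (rule compact_nest_nat[OF Y_compact Y_nonempty]) (auto simp: Y_def)
  have "closed Z"
    unfolding Z_def using Y_compact by (intro closed_INT) (auto simp: compact_imp_closed)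
  then have Z_compact: "compact Z"
    using compact_Int_closed[OF compact_X, of Z] Z_iff by (simp add: inf.absorb2 subset_iff)
  have Z_X: "Z \<subseteq> X"
    using Z_iff by blast
  have Z_G: "(f ^^ (G * i)) x \<in> Z" if "x \<in> Z" for x i
  proof -
    have "(f ^^ (G * j)) ((f ^^ (G * i)) x) = (f ^^ (G * (j + i))) x" for j
      by (simp add: distrib_left funpow_add)
    then show ?thesis
      using that by (simp add: Z_iff iter_in)
  qed
  define C where "C i = (f ^^ i) ` Z" for i
  have C_closed: "closed (C i)" for i
    unfolding C_def using continuous_on_subset[OF continuous_iter Z_X] Z_compact
    by (intro compact_imp_closed compact_continuous_image)
  \<comment> \<open>Minimality is known for \<open>f\<close>, not for \<open>f ^^ G\<close>. The
    first \<open>G\<close> images of the \<open>f ^^ G\<close>-invariant set \<open>Z\<close> have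
    an \<open>f\<close>-invariant union, which must be \<open>X\<close>, and one of them then has
    interior.\<close>
  have "(\<Union>i<G. C i) = X"
  proof (rule invariant_closed)
    show "closed (\<Union>i<G. C i)"
      using C_closed by (intro closed_UN) auto
    show "(\<Union>i<G. C i) \<noteq> {}"
      using \<open>Z \<noteq> {}\<close> G(1) by (auto simp: C_def Suc_le_eq)
    show "(\<Union>i<G. C i) \<subseteq> X"
      using Z_X iter_in by (auto simp: C_def)
    show "f ` (\<Union>i<G. C i) \<subseteq> (\<Union>i<G. C i)"
    proof
      fix y assume "y \<in> f ` (\<Union>i<G. C i)"
      then obtain i z where iz: "i < G" "z \<in> Z" "y = (f ^^ Suc i) z"
        by (auto simp: C_def)
      show "y \<in> (\<Union>i<G. C i)"
      proof (cases "Suc i = G")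
        case True
        then have "y \<in> C 0"
          using Z_G[OF iz(2), of 1] iz(3) by (simp add: C_def)
        then show ?thesis
          using G(1) by (auto simp: Suc_le_eq)
      next
        case False
        then have "Suc i < G"
          using iz(1) by simp
        moreover have "y \<in> C (Suc i)"
          unfolding C_def using iz(2,3) by blast
        ultimately show ?thesis
          by blast
      qed
    qed
  qed
  then have "X \<subseteq> (\<Union>i<G. C i)"
    by simp
  then have "\<exists>i<G. \<exists>U. openin (top_of_set X) U \<and> U \<noteq> {} \<and> U \<subseteq> C i"
    by (rule openin_finite_closed_cover[of C, OF C_closed openin_subtopology_self nonempty_X])
  then obtain i U where i: "i < G" and U: "openin (top_of_set X) U" "U \<noteq> {}" "U \<subseteq> C i"
    by blast
  \<comment> \<open>Every multiple of \<open>G\<close> maps \<open>C i\<close> into itself, so no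
    such multiple is a hitting time from \<open>U\<close> to the complement. Thick hitting times,
    however, include a multiple of \<open>G\<close>.\<close>
  have "X \<subseteq> C i"
  proof (rule ccontr)
    assume "\<not> X \<subseteq> C i"
    then have V: "openin (top_of_set X) (X - C i)" "X - C i \<noteq> {}"
      using C_closed[of i] by (auto simp: Diff_eq open_Compl openin_open_Int)
    obtain k where k: "k \<ge> 1" "\<And>j. j \<le> G \<Longrightarrow> hits U (X - C i) (k + j)"
      by (rule hits_thick[OF U(1,2) V]) blast
    \<comment> \<open>This offset, between 1 and \<open>G\<close>, moves \<open>k\<close> to the
      next larger multiple of \<open>G\<close>.\<close>
    define j where "j = G - k mod G"
    have "k mod G < G"
      using G(1) by simp
    then have "k + j = G * (k div G) + G"
      unfolding j_def using mult_div_mod_eq[of G k] by linarith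
    then have "k + j = G * (k div G + 1)"
      by simp
    moreover have "hits U (X - C i) (k + j)"
      by (rule k(2)) (simp add: j_def)
    ultimately obtain u where u: "u \<in> U" "(f ^^ (G * (k div G + 1))) u \<notin> C i"
      by (auto simp: hits_def)
    obtain z where z: "z \<in> Z" "u = (f ^^ i) z"
      using u(1) U(3) by (auto simp: C_def)
    have "(f ^^ (G * (k div G + 1))) u = (f ^^ i) ((f ^^ (G * (k div G + 1))) z)"
      unfolding z(2) by (metis add.commute comp_apply funpow_add)
    then show False
      using u(2) Z_G[OF z(1)] by (simp only: C_def imageI not_True_eq_False)
  qed
  \<comment> \<open>A preimage of \<open>a\<close> under \<open>f ^^ (G - i)\<close> lies in
    \<open>C i\<close>, so some point of \<open>Z\<close> reaches \<open>a\<close> after exactly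
    \<open>G\<close> steps, although its \<open>f ^^ G\<close>-orbit must avoid a ball around
    \<open>\<Phi> a\<close>.\<close>
  have "a \<in> (f ^^ (G - i)) ` X"
    using a by (simp add: surj_iter)
  then obtain w where w: "w \<in> X" "(f ^^ (G - i)) w = a"
    by auto
  then have "w \<in> C i"
    using \<open>X \<subseteq> C i\<close> by (rule_tac subsetD)
  then obtain z where z: "z \<in> Z" "w = (f ^^ i) z"
    unfolding C_def by auto
  have "(f ^^ G) z = a"
    using w(2) i funpow_add[of "G - i" i f] unfolding z(2) by simp
  moreover have "\<eta> / 6 \<le> dist (\<Phi> ((f ^^ (G * 1)) z)) (\<Phi> a)"
    using z(1) unfolding Z_iff by blast
  ultimately show False
    using \<eta>(1) by simp
qed

end

section \<open>A collapsing map into a sequence space, and the conclusion\<close>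

lemma (in suslinean_mixing) inconsistent: False
proof -
  obtain g :: "'a \<Rightarrow> real" and a b where g: "continuous_on X g" "\<And>x y. x \<in> X \<Longrightarrow> y \<in> class_of x \<Longrightarrow> g y = g x"
    "a \<in> X" "b \<in> X" "g a \<noteq> g b"
    by (rule exists_class_function) blast
  \<comment> \<open>The map \<open>f\<close> need not descend along \<open>g\<close> alone.
    Recording \<open>g\<close> along the whole orbit turns \<open>f\<close> into the shift
    \<open>\<sigma>\<close>, which is uniformly continuous on the compact image of
    \<open>X\<close>.\<close>
  define \<Phi> :: "'a \<Rightarrow> nat \<Rightarrow> real" where "\<Phi> x = (\<lambda>k. g ((f ^^ k) x))" for x
  define \<sigma> :: "(nat \<Rightarrow> real) \<Rightarrow> nat \<Rightarrow> real" where "\<sigma> y = (\<lambda>k. y (Suc k))" for y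
  have \<Phi>_cont: "continuous_on X \<Phi>"
    unfolding \<Phi>_def
  proof (intro continuous_on_coordinatewise_then_product)
    show "continuous_on X (\<lambda>x. g ((f ^^ k) x))" for k
      by (rule continuous_on_compose2[OF g(1) continuous_iter]) (auto simp: iter_in)
  qed
  have "continuous_on (\<Phi> ` X) \<sigma>"
    unfolding \<sigma>_def
    by (intro continuous_on_coordinatewise_then_product continuous_on_product_coordinates continuous_on_subset[OF _ subset_UNIV])
  then have \<sigma>: "uniformly_continuous_on (\<Phi> ` X) \<sigma>"
    using compact_continuous_image[OF \<Phi>_cont compact_X] by (rule compact_uniformly_continuous)
  have \<sigma>\<Phi>: "\<sigma> (\<Phi> x) = \<Phi> (f x)" for x
    by (simp add: \<sigma>_def \<Phi>_def funpow_swap1)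
  have "\<Phi> a \<noteq> \<Phi> b"
    using g(5) by (auto simp: \<Phi>_def fun_eq_iff intro: exI[of _ 0])
  interpret class_collapse X f \<Phi> a b "dist (\<Phi> a) (\<Phi> b) / 5"
  proof
    show "\<Phi> x = \<Phi> y" if K: "subcontinuum K X" "asymptotic K" "x \<in> K" "y \<in> K" for K x y
    proof -
      have "y \<in> class_of x" "x \<in> X"
        using K in_class_of_iff subcontinuum_subset by blast+
      then have "g ((f ^^ k) y) = g ((f ^^ k) x)" for k
        by (intro g(2) class_of_iter iter_in)
      then show ?thesis
        by (simp add: \<Phi>_def)
    qed
    show "\<exists>\<kappa>>0. \<forall>x\<in>X. \<forall>y\<in>X. dist (\<Phi> x) (\<Phi> y) < \<kappa> \<longrightarrow> dist (\<Phi> (f x)) (\<Phi> (f y)) < \<theta>" if "\<theta> > 0" for \<theta>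
      using \<sigma> that unfolding uniformly_continuous_on_def by (fastforce simp: \<sigma>\<Phi>)
    show "continuous_on X \<Phi>" "a \<in> X" "b \<in> X"
      by fact+
  qed (use \<open>\<Phi> a \<noteq> \<Phi> b\<close> in simp_all)
  show False
    by (rule contradiction)
qed

theorem theorem4p4:
  fixes X :: "'a::metric_space set" and f :: "'a \<Rightarrow> 'a"
  assumes "continuum X" and "finitely_suslinean X"
    and nondegenerate: "\<not> is_singleton X"
    and "minimal_map X f"
  shows "\<not> weakly_mixing X f"
proof
  assume "weakly_mixing X f"
  then interpret suslinean_mixing X f
    by unfold_locales (use assms in auto)
  show False
    by (rule inconsistent)
qed

end
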